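(* Let $n$ be the number of players, and let $0<\epsilon\le 1$ be a real number, $r$ a positive integer with $r\le \epsilon n/127$, and $t>3/2$ a constant real number. There is a randomized algorithm in the Robertson–Webb query model which consists of two parts: (1) a preassigning part which selects (itself) a set of $r$ players and assigns fair portions to these $r$ players using $O(tr/\epsilon)$ queries; and (2) a completion part which, using $O(n\log n)$ queries, assigns fair portions of the remaining cake to all of the remaining $n-r$ players except for at most $\epsilon n$ of them (the "victims"). With probability at least $$1-\frac{8}{(2t-3)^2 r}-\left(\frac{1}{64}\right)^{t/\epsilon},$$ all of these guarantees hold simultaneously (the $r$ preassigned players and all non-victim remaining players receive fair portions, and all portions are pairwise disjoint).
   Context: Cake-cutting setting: $P$ is a set of $n$ players, and the algorithm knows $n$. The cake is the interval $C=[0,1]$. Each player $p$ has a nonnegative additive value function $\mu_p$ defined on measurable subsets of $C$, with $\mu_p(C)=1$. A portion is a set of disjoint subintervals of $C$; portions given to different players are disjoint. A portion $C_p$ is fair for $p$ if $\mu_p(C_p)\ge 1/n$. Players answer queries honestly. Robertson–Webb model: the algorithm accesses the value functions only via (i) cut queries $\mathrm{Cut}([a,b],p,\alpha)$, returning the smallest $x\in[a,b]$ with $\mu_p([a,x])=\alpha$ (or a special message if $\mu_p([a,b])<\alpha$), and (ii) evaluation queries $\mathrm{Eval}([a,b],p,x)$, returning $\mu_p([a,x])$; the running time of an algorithm is its number of queries. In this theorem the $r$ preassigned players are not prescribed in advance: the algorithm may choose which $r$ players are preassigned. *)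

theory Defs
  imports "HOL-Probability.Probability" "HOL-Library.Disjoint_Sets"
begin

definition cake :: "real set" where
  "cake = {0..1}"

text \<open>
  Only finite additivity is assumed. The last clause (divisibility) says that every cut query which
  asks for no more than the value of the interval has an answer. Together with monotonicity it
  makes \<open>\<lambda>x. \<mu> {a..x}\<close> continuous, so there is then also a smallest answer.
\<close>

definition value_function :: "(real set \<Rightarrow> real) \<Rightarrow> bool" where
  "value_function \<mu> \<longleftrightarrow>
     (\<forall>A\<in>sets (restrict_space borel cake). 0 \<le> \<mu> A) \<and>
     additive (sets (restrict_space borel cake)) \<mu> \<and>
     \<mu> cake = 1 \<and>
     (\<forall>a b \<alpha>. 0 \<le> a \<and> a \<le> b \<and> b \<le> 1 \<and> 0 \<le> \<alpha> \<and> \<alpha> \<le> \<mu> {a..b} \<longrightarrow>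
        (\<exists>x\<in>{a..b}. \<mu> {a..x} = \<alpha>))"

type_synonym portion = "real set set"

definition is_portion :: "portion \<Rightarrow> bool" where
  "is_portion C \<longleftrightarrow> finite C \<and> disjoint C \<and> (\<forall>I\<in>C. is_interval I \<and> I \<subseteq> cake)"

definition fair :: "nat \<Rightarrow> (real set \<Rightarrow> real) \<Rightarrow> portion \<Rightarrow> bool" where
  "fair n \<mu> C \<longleftrightarrow> \<mu> (\<Union>C) \<ge> 1 / real n"

text \<open>The players are \<open>0, \<dots>, n - 1\<close>.\<close>

type_synonym player = nat
type_synonym valuation = "player \<Rightarrow> real set \<Rightarrow> real"
type_synonym allocation = "player \<rightharpoonup> portion"

text \<open>\<open>Cut a b p \<alpha>\<close> and \<open>Eval a b p x\<close> are the queries about the interval \<open>[a, b]\<close>.\<close>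

datatype query = Cut real real player real | Eval real real player real

fun legal_query :: "nat \<Rightarrow> query \<Rightarrow> bool" where
  "legal_query n (Cut a b p \<alpha>) \<longleftrightarrow> 0 \<le> a \<and> a \<le> b \<and> b \<le> 1 \<and> p < n \<and> 0 \<le> \<alpha>"
| "legal_query n (Eval a b p x) \<longleftrightarrow> 0 \<le> a \<and> a \<le> x \<and> x \<le> b \<and> b \<le> 1 \<and> p < n"

fun honest_answer :: "valuation \<Rightarrow> query \<Rightarrow> real option" where
  "honest_answer V (Cut a b p \<alpha>) =
     (if V p {a..b} < \<alpha> then None else Some (LEAST x. x \<in> {a..b} \<and> V p {a..x} = \<alpha>))"
| "honest_answer V (Eval a b p x) = Some (V p {a..x})"

text \<open>Illegal queries are counted but reveal nothing about the valuation.\<close>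

definition answer :: "nat \<Rightarrow> valuation \<Rightarrow> query \<Rightarrow> real option" where
  "answer n V q = (if legal_query n q then honest_answer V q else None)"

text \<open>
  A randomized Robertson--Webb algorithm is a decision tree. Its inner nodes ask a query and
  branch on the answer, or draw a random number, which is free of charge. The value functions can
  therefore influence the result only through the answers to queries.
\<close>

datatype 'a rw = Return 'a | Query query "real option \<Rightarrow> 'a rw" | Random "nat pmf" "nat \<Rightarrow> 'a rw"

text \<open>The joint distribution of the result and the number of queries.\<close>

primrec run :: "nat \<Rightarrow> valuation \<Rightarrow> 'a rw \<Rightarrow> ('a \<times> nat) pmf" where
  "run n V (Return x) = return_pmf (x, 0)"
| "run n V (Query q k) = map_pmf (\<lambda>(x, c). (x, Suc c)) (run n V (k (answer n V q)))"
| "run n V (Random D k) = bind_pmf D (\<lambda>i. run n V (k i))"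

text \<open>
  The preassigning part returns the portions of the players it has selected (the domain of the
  allocation) and the completion part. Since the latter is a component of the result, it may depend
  on all query answers and random choices of the preassigning part.
\<close>

type_synonym two_part_algorithm = "(allocation \<times> allocation rw) rw"

text \<open>The two allocations are returned with the number of queries spent in the respective part.\<close>

definition execute ::
    "nat \<Rightarrow> valuation \<Rightarrow> two_part_algorithm \<Rightarrow> ((allocation \<times> nat) \<times> (allocation \<times> nat)) pmf" where
  "execute n V A =
     bind_pmf (run n V A) (\<lambda>((Q, B), c1).
     bind_pmf (run n V B) (\<lambda>(R, c2).
     return_pmf ((Q, c1), (R, c2))))"

definition disjoint_portions :: "allocation \<Rightarrow> bool" where
  "disjoint_portions F \<longleftrightarrow>
     (\<forall>p q C D. F p = Some C \<and> F q = Some D \<and> p \<noteq> q \<longrightarrow> \<Union>C \<inter> \<Union>D = {})"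

text \<open>A victim may receive no portion or an unfair one.\<close>

definition victims :: "nat \<Rightarrow> valuation \<Rightarrow> allocation \<Rightarrow> allocation \<Rightarrow> player set" where
  "victims n V Q R =
     {p \<in> {..<n} - dom Q. \<not> (\<exists>C. R p = Some C \<and> fair n (V p) C)}"

definition success ::
    "nat \<Rightarrow> nat \<Rightarrow> real \<Rightarrow> valuation \<Rightarrow> allocation \<Rightarrow> allocation \<Rightarrow> bool" where
  "success n r \<epsilon> V Q R \<longleftrightarrow>
     dom Q \<subseteq> {..<n} \<and> card (dom Q) = r \<and>
     dom R \<subseteq> {..<n} - dom Q \<and>
     (\<forall>C \<in> ran Q \<union> ran R. is_portion C) \<and>
     disjoint_portions (Q ++ R) \<and>
     (\<forall>p C. Q p = Some C \<longrightarrow> fair n (V p) C) \<and>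
     real (card (victims n V Q R)) \<le> \<epsilon> * real n"

end

theory Submission
  imports Defs
begin

text \<open>
  Draw about \<open>64 t r / \<epsilon>\<close> random players and let each mark the point up to which the cake is worth
  \<open>\<epsilon>\<close>. Let \<open>x\<close> be the \<open>8 r\<close>-th smallest mark of the distinct players drawn. The sample contains
  \<open>8 r\<close> distinct players below the \<open>\<epsilon>\<close>-quantile of all marks except with probability
  exponentially small in \<open>t r\<close>, and then at most \<open>\<epsilon> n\<close> players value \<open>[0, x]\<close> at more than \<open>\<epsilon>\<close>.

  Each of the \<open>8 r\<close> players with the smallest marks can cut \<open>127 r\<close> consecutive pieces of value
  \<open>1 / n\<close> out of \<open>[0, x]\<close> and picks one of them at random, with two queries. Since two players'
  subdivisions have at most \<open>2 \<cdot> 127 r\<close> overlapping pairs of pieces, two picks overlap with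
  probability at most \<open>2 / (127 r)\<close>, so the largest number of disjoint picks has expectation at
  least \<open>7 r\<close>. It changes by at most one with each pick, so its variance is at most \<open>8 r\<close> and by
  Chebyshev it is less than \<open>r\<close> with probability at most \<open>1 / (4 r)\<close>. About \<open>t\<close> independent
  trials push the probability that all of them fail below \<open>1 / (t\<^sup>2 r)\<close>.

  At least \<open>1 - \<epsilon>\<close> of the cake remains in \<open>[x, 1]\<close> for all but \<open>\<epsilon> n\<close> players, which is enough to
  serve \<open>\<lfloor>(1 - \<epsilon>) n\<rfloor>\<close> of them by the divide-and-conquer algorithm of Even and Paz.
\<close>

subsection \<open>Value functions, queries and the Even--Paz algorithm\<close>

lemma interval_in_cake_sets:
  assumes "0 \<le> a" "b \<le> 1"
  shows "{a..b} \<in> sets (restrict_space borel cake)" "{a<..b} \<in> sets (restrict_space borel cake)"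
  using assms by (auto simp: sets_restrict_space_iff cake_def)

lemma value_function_nonneg:
  assumes "value_function \<mu>" "A \<in> sets (restrict_space borel cake)"
  shows "0 \<le> \<mu> A"
  using assms by (auto simp: value_function_def)

text \<open>Divisibility asks for a cut of \<open>{a..a}\<close> at value 0, and \<open>a\<close> is
  the only point available.\<close>

lemma value_function_point:
  assumes "value_function \<mu>" "0 \<le> a" "a \<le> 1"
  shows "\<mu> {a..a} = 0"
proof -
  have "0 \<le> \<mu> {a..a}"
    using assms by (intro value_function_nonneg[OF assms(1)] interval_in_cake_sets)
  moreover have "\<forall>a b \<alpha>. 0 \<le> a \<and> a \<le> b \<and> b \<le> 1 \<and> 0 \<le> \<alpha> \<and> \<alpha> \<le> \<mu> {a..b} \<longrightarrow>
        (\<exists>x\<in>{a..b}. \<mu> {a..x} = \<alpha>)"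
    using assms(1) by (simp add: value_function_def)
  ultimately have "\<exists>x\<in>{a..a}. \<mu> {a..x} = 0"
    using assms(2,3) by blast
  then show ?thesis by force
qed

lemma value_function_split:
  assumes "value_function \<mu>" "0 \<le> a" "a \<le> x" "x \<le> b" "b \<le> 1"
  shows "\<mu> {a..b} = \<mu> {a..x} + \<mu> {x<..b}"
proof -
  have "additive (sets (restrict_space borel cake)) \<mu>"
    using assms(1) by (simp add: value_function_def)
  then have "\<mu> ({a..x} \<union> {x<..b}) = \<mu> {a..x} + \<mu> {x<..b}"
    by (rule additiveD) (use assms in \<open>auto intro: interval_in_cake_sets\<close>)
  moreover have "{a..x} \<union> {x<..b} = {a..b}" using assms by auto
  ultimately show ?thesis by simp
qed

text \<open>End points are worthless. Half-open pieces, which stay disjoint where closed ones would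
  share an end point, can therefore be measured by queries about closed intervals.\<close>

lemma value_function_half_open:
  assumes "value_function \<mu>" "0 \<le> a" "a \<le> b" "b \<le> 1"
  shows "\<mu> {a<..b} = \<mu> {a..b}"
  using value_function_split[of \<mu> a a b] value_function_point[of \<mu> a] assms by simp

lemma value_function_mono:
  assumes "value_function \<mu>" "0 \<le> a" "x \<le> y" "y \<le> 1"
  shows "\<mu> {a..x} \<le> \<mu> {a..y}"
proof (cases "a \<le> x")
  case True
  have "0 \<le> \<mu> {x<..y}"
    using assms True by (intro value_function_nonneg[OF assms(1)] interval_in_cake_sets) auto
  then show ?thesis using value_function_split[of \<mu> a x y] assms True by simp
next
  case False
  \<comment> \<open>Here \<open>{a..x}\<close> is empty, and additivity on the empty union forces
    its value to be 0.\<close>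
  have "\<mu> {} = 0"
  proof -
    have "additive (sets (restrict_space borel cake)) \<mu>"
      using assms(1) by (simp add: value_function_def)
    then have "\<mu> ({} \<union> {}) = \<mu> {} + \<mu> {}"
      by (intro additiveD) auto
    then show ?thesis by simp
  qed
  moreover have "0 \<le> \<mu> {a..y}"
    using assms by (intro value_function_nonneg[OF assms(1)] interval_in_cake_sets) auto
  ultimately show ?thesis using False by simp
qed

section \<open>Honest answers and batches of queries\<close>

lemma answer_Eval:
  assumes "0 \<le> a" "a \<le> x" "x \<le> b" "b \<le> 1" "p < n"
  shows "answer n V (Eval a b p x) = Some (V p {a..x})"
  using assms by (simp add: answer_def)

text \<open>The set of candidate cuts is bounded below, and its infimum belongs to it because
  \<open>\<lambda>x. \<mu> {a..x}\<close> is monotone without gaps in its range.\<close>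

lemma answer_Cut:
  assumes V: "value_function (V p)"
    and ab: "0 \<le> a" "a \<le> b" "b \<le> 1" "p < n" "0 \<le> \<alpha>" "\<alpha> \<le> V p {a..b}"
  obtains z where "answer n V (Cut a b p \<alpha>) = Some z" "a \<le> z" "z \<le> b" "V p {a..z} = \<alpha>"
proof -
  define S where "S = {x. x \<in> {a..b} \<and> V p {a..x} = \<alpha>}"
  have div: "\<exists>x\<in>{a..b}. V p {a..x} = \<beta>" if "0 \<le> \<beta>" "\<beta> \<le> V p {a..b}" for \<beta>
    using V ab that by (auto simp: value_function_def)
  have ne: "S \<noteq> {}" using div[of \<alpha>] ab by (auto simp: S_def)
  have bdd: "bdd_below S" unfolding S_def by (rule bdd_belowI[of _ a]) auto
  define z where "z = Inf S"
  have za: "a \<le> z" unfolding z_def using ne by (intro cInf_greatest) (auto simp: S_def)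
  have lower: "z \<le> s" if "s \<in> S" for s unfolding z_def using that bdd by (rule cInf_lower)
  obtain s where s: "s \<in> S" using ne by auto
  have zb: "z \<le> b" using lower[OF s] s by (auto simp: S_def)
  have "V p {a..z} \<le> \<alpha>"
    using value_function_mono[OF V ab(1), of z s] lower[OF s] s ab by (auto simp: S_def)
  \<comment> \<open>By divisibility a value halfway between would be attained at some
    \<open>w\<close>. This \<open>w\<close> is a lower bound of \<open>S\<close>, so
    \<open>w \<le> z\<close>, against monotonicity.\<close>
  moreover have False if less: "V p {a..z} < \<alpha>"
  proof -
    have "0 \<le> V p {a..z}"
      using ab zb by (intro value_function_nonneg[OF V] interval_in_cake_sets) auto
    then obtain w where w: "w \<in> {a..b}" "V p {a..w} = (V p {a..z} + \<alpha>) / 2"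
      using div[of "(V p {a..z} + \<alpha>) / 2"] less ab by auto
    have "w \<le> s" if "s \<in> S" for s
      using value_function_mono[OF V ab(1), of s w] w less that ab
      by (cases "w \<le> s") (auto simp: S_def)
    then have "w \<le> z" unfolding z_def using ne by (intro cInf_greatest)
    then show False
      using value_function_mono[OF V ab(1), of w z] w less zb ab by auto
  qed
  ultimately have zS: "z \<in> S" using za zb by (force simp: S_def)
  have "(LEAST x. x \<in> {a..b} \<and> V p {a..x} = \<alpha>) = z"
    using zS lower by (intro Least_equality) (auto simp: S_def)
  then have "answer n V (Cut a b p \<alpha>) = Some z"
    using ab by (simp add: answer_def)
  then show ?thesis using that zS by (auto simp: S_def)
qed

text \<open>A nonadaptive batch in continuation-passing style. The answers are passed on as a
  function, with default 0 at indices outside the list; a repeated index is paid for again.\<close>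

primrec ask :: "'i list \<Rightarrow> ('i \<Rightarrow> query) \<Rightarrow> (('i \<Rightarrow> real) \<Rightarrow> 'a rw) \<Rightarrow> 'a rw" where
  "ask [] g k = k (\<lambda>_. 0)"
| "ask (x # xs) g k = Query (g x) (\<lambda>a. ask xs g (\<lambda>f. k (f(x := the a))))"

text \<open>An answer is determined by query and valuation, so a batch introduces no randomness and
  only shifts the query count.\<close>

lemma run_ask:
  "run n V (ask xs g k) = map_pmf (apsnd ((+) (length xs)))
     (run n V (k (\<lambda>i. if i \<in> set xs then the (answer n V (g i)) else 0)))"
proof (induction xs arbitrary: k)
  case Nil
  then show ?case by (simp add: apsnd_def map_prod_def)
next
  case (Cons x xs)
  have "(\<lambda>i. if i \<in> set xs then the (answer n V (g i)) else 0)(x := the (answer n V (g x)))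
      = (\<lambda>i. if i \<in> set (x # xs) then the (answer n V (g i)) else 0)"
    by auto
  then show ?case
    by (simp add: Cons.IH map_pmf_comp) (simp add: case_prod_unfold apsnd_def map_prod_def)
qed

section \<open>Order statistics\<close>

lemma sort_key_split:
  fixes y :: "'a \<Rightarrow> 'b :: linorder"
  assumes "0 < h" "h \<le> length xs"
  shows "p \<in> set (take h (sort_key y xs)) \<Longrightarrow> y p \<le> y (sort_key y xs ! (h - 1))"
    and "p \<in> set (drop (h - 1) (sort_key y xs)) \<Longrightarrow> y (sort_key y xs ! (h - 1)) \<le> y p"
proof -
  let ?zs = "sort_key y xs"
  have mono: "y (?zs ! i) \<le> y (?zs ! j)" if "i \<le> j" "j < length xs" for i j
    using sorted_nth_mono[OF sorted_sort_key[of y xs], of i j] that by simp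
  { assume "p \<in> set (take h ?zs)"
    then obtain i where "i < h" "p = ?zs ! i"
      using assms by (auto simp: in_set_conv_nth)
    then show "y p \<le> y (?zs ! (h - 1))" using assms by (auto intro!: mono) }
  { assume "p \<in> set (drop (h - 1) ?zs)"
    then obtain i where "i < length (drop (h - 1) ?zs)" "p = drop (h - 1) ?zs ! i"
      by (metis in_set_conv_nth)
    then have "h - 1 + i < length xs" "p = ?zs ! (h - 1 + i)"
      using assms by auto
    then show "y (?zs ! (h - 1)) \<le> y p" by (auto intro!: mono) }
qed

text \<open>Only the \<open>h - 1\<close> entries sorted before the \<open>h\<close>-th smallest one
  can have a strictly smaller key.\<close>

lemma card_less_sort_key_nth:
  fixes y :: "'a \<Rightarrow> 'b :: linorder"
  assumes "0 < h" "h \<le> length xs"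
  shows "card {p \<in> set xs. y p < y (sort_key y xs ! (h - 1))} < h"
proof -
  let ?zs = "sort_key y xs"
  have "set xs = set (take (h - 1) ?zs) \<union> set (drop (h - 1) ?zs)"
    by (metis append_take_drop_id set_append set_sort)
  then have "{p \<in> set xs. y p < y (?zs ! (h - 1))} \<subseteq> set (take (h - 1) ?zs)"
    using sort_key_split(2)[OF assms, of _ y] by fastforce
  then have "card {p \<in> set xs. y p < y (?zs ! (h - 1))} \<le> length (take (h - 1) ?zs)"
    by (meson List.finite_set card_length card_mono order_trans)
  then show ?thesis using assms by simp
qed

text \<open>The value of rank \<open>\<lceil>m\<rceil>\<close> works. Because of ties, the lower
  bound has to count weakly smaller values and the upper bound strictly smaller ones.\<close>

lemma quantile_exists:
  fixes y :: "nat \<Rightarrow> real"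
  assumes "0 < m" "m \<le> real n"
  obtains v where "m \<le> real (card {p. p < n \<and> y p \<le> v})" "real (card {p. p < n \<and> y p < v}) \<le> m"
proof -
  define h where "h = nat \<lceil>m\<rceil>"
  have h: "0 < h" "h \<le> length [0..<n]" using assms by (auto simp: h_def ceiling_le_iff)
  let ?zs = "sort_key y [0..<n]"
  let ?v = "y (?zs ! (h - 1))"
  have "set (take h ?zs) \<subseteq> {p. p < n \<and> y p \<le> ?v}"
    using sort_key_split(1)[OF h, of _ y] set_take_subset[of h ?zs] by auto
  then have "card (set (take h ?zs)) \<le> card {p. p < n \<and> y p \<le> ?v}"
    by (intro card_mono) auto
  moreover have "card (set (take h ?zs)) = h"
    using h by (subst distinct_card) auto
  ultimately have "m \<le> real (card {p. p < n \<and> y p \<le> ?v})"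
    unfolding h_def by linarith
  moreover have "card {p. p < n \<and> y p < ?v} < h"
    using card_less_sort_key_nth[OF h, of y] by simp
  then have "real (card {p. p < n \<and> y p < ?v}) \<le> m"
    unfolding h_def by linarith
  ultimately show ?thesis by (rule that)
qed

section \<open>Allocations inside an interval and the Even--Paz recursion\<close>

definition serves :: "nat \<Rightarrow> valuation \<Rightarrow> player set \<Rightarrow> real \<Rightarrow> real \<Rightarrow> allocation \<Rightarrow> bool" where
  "serves n V P a b R \<longleftrightarrow> dom R = P \<and> disjoint_portions R \<and>
     (\<forall>p C. R p = Some C \<longrightarrow> is_portion C \<and> \<Union>C \<subseteq> {a<..b} \<and> fair n (V p) C)"

text \<open>The half-open ranges on the two sides of \<open>z\<close> keep the two families apart.
  This joins the halves of an Even--Paz round and, later, the preassigned pieces with those of the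
  completion part.\<close>

lemma serves_merge:
  assumes "serves n V P a z R" "serves n V P' z b R'" "a \<le> z" "z \<le> b"
  shows "serves n V (P \<union> P') a b (R ++ R')"
  unfolding serves_def
proof (intro conjI allI impI)
  show "dom (R ++ R') = P \<union> P'" using assms by (auto simp: serves_def)
  show "disjoint_portions (R ++ R')"
    unfolding disjoint_portions_def
  proof (intro allI impI, elim conjE)
    fix p q C D assume *: "(R ++ R') p = Some C" "(R ++ R') q = Some D" "p \<noteq> q"
    consider "R p = Some C" "R q = Some D" | "R' p = Some C" "R' q = Some D"
      | "R p = Some C" "R' q = Some D" | "R' p = Some C" "R q = Some D"
      using * by (auto simp: map_add_Some_iff)
    then show "\<Union>C \<inter> \<Union>D = {}"
    proof cases
      case 1
      then show ?thesis using assms(1) * by (auto simp: serves_def disjoint_portions_def)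
    next
      case 2
      then show ?thesis using assms(2) * by (auto simp: serves_def disjoint_portions_def)
    next
      case 3
      then have "\<Union>C \<subseteq> {a<..z}" "\<Union>D \<subseteq> {z<..b}" using assms by (auto simp: serves_def)
      moreover have "{a<..z} \<inter> {z<..b} = {}" by auto
      ultimately show ?thesis by blast
    next
      case 4
      then have "\<Union>C \<subseteq> {z<..b}" "\<Union>D \<subseteq> {a<..z}" using assms by (auto simp: serves_def)
      moreover have "{a<..z} \<inter> {z<..b} = {}" by auto
      ultimately show ?thesis by blast
    qed
  qed
next
  fix p C assume "(R ++ R') p = Some C"
  then have "R p = Some C \<or> R' p = Some C" by auto
  moreover have "{a<..z} \<subseteq> {a<..b}" "{z<..b} \<subseteq> {a<..b}" using assms by auto
  ultimately show "is_portion C" "\<Union>C \<subseteq> {a<..b}" "fair n (V p) C"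
    using assms(1,2) unfolding serves_def by blast+
qed

lemma is_portion_half_open:
  assumes "0 \<le> a" "b \<le> 1"
  shows "is_portion {{a<..b}}"
  using assms by (auto simp: is_portion_def cake_def disjoint_def is_interval_1)

text \<open>All players value the interval at one \<open>n\<close>-th per head at least, so the algorithm
  can aim for absolute values instead of fractions of the interval. The first argument bounds the
  depth of the recursion.\<close>

primrec even_paz ::
    "nat \<Rightarrow> nat \<Rightarrow> player list \<Rightarrow> real \<Rightarrow> real \<Rightarrow> (allocation \<Rightarrow> 'a rw) \<Rightarrow> 'a rw" where
  "even_paz 0 n ps a b k = k (\<lambda>p. if p \<in> set ps then Some {{a<..b}} else None)"
| "even_paz (Suc d) n ps a b k =
    (if length ps \<le> 1 then k (\<lambda>p. if p \<in> set ps then Some {{a<..b}} else None)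
     else let h = length ps div 2 in
       ask ps (\<lambda>p. Cut a b p (real h / real n)) (\<lambda>c.
         let qs = sort_key c ps; z = c (qs ! (h - 1)) in
         even_paz d n (take h qs) a z (\<lambda>R.
         even_paz d n (drop h qs) z b (\<lambda>R'. k (R ++ R')))))"

lemma serves_at_most_one:
  assumes V: "\<forall>p<n. value_function (V p)"
    and ps: "set ps \<subseteq> {..<n}" "length ps \<le> 1"
    and ab: "0 \<le> a" "a \<le> b" "b \<le> 1"
    and val: "\<forall>p\<in>set ps. real (length ps) / real n \<le> V p {a..b}"
  shows "serves n V (set ps) a b (\<lambda>p. if p \<in> set ps then Some {{a<..b}} else None)"
proof -
  have "p = q" if "p \<in> set ps" "q \<in> set ps" for p q
    using ps(2) that by (cases ps) auto
  moreover have "1 / real n \<le> V p {a<..b}" if p: "p \<in> set ps" for p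
  proof -
    have "length ps = 1" using p ps(2) by (cases ps) auto
    moreover have "V p {a<..b} = V p {a..b}"
      using V ps p ab by (intro value_function_half_open) auto
    ultimately show ?thesis using val p by auto
  qed
  ultimately show ?thesis
    using is_portion_half_open[OF ab(1,3)]
    by (auto simp: serves_def disjoint_portions_def fair_def split: if_splits)
qed

text \<open>Each level of the recursion costs one cut per player, and halving keeps the list within
  \<open>2 ^ d\<close>. \<open>R\<close> and \<open>c\<close> are fixed before the continuation
  \<open>k\<close>, so that the second recursive call, which sits in the continuation of the first,
  can be evaluated after it.\<close>

lemma run_even_paz:
  assumes V: "\<forall>p<n. value_function (V p)"
  assumes "distinct ps" "set ps \<subseteq> {..<n}" "length ps \<le> 2 ^ d"
    and "0 \<le> a" "a \<le> b" "b \<le> 1"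
    and "\<forall>p\<in>set ps. real (length ps) / real n \<le> V p {a..b}"
  shows "\<exists>R c. c \<le> d * length ps \<and> serves n V (set ps) a b R \<and>
    (\<forall>k :: allocation \<Rightarrow> 'a rw. run n V (even_paz d n ps a b k) = map_pmf (apsnd ((+) c)) (run n V (k R)))"
  using assms(2-)
proof (induction d arbitrary: ps a b)
  case 0
  then show ?case
    using serves_at_most_one[OF V, of ps a b]
    by (intro exI[of _ "\<lambda>p. if p \<in> set ps then Some {{a<..b}} else None"] exI[of _ 0])
       (auto simp: apsnd_def map_prod_def)
next
  case (Suc d)
  show ?case
  proof (cases "length ps \<le> 1")
    case True
    then show ?thesis
      using serves_at_most_one[OF V, of ps a b] Suc.prems
      by (intro exI[of _ "\<lambda>p. if p \<in> set ps then Some {{a<..b}} else None"] exI[of _ 0])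
         (auto simp: apsnd_def map_prod_def)
  next
    case False
    define h where "h = length ps div 2"
    have h: "0 < h" "h \<le> length ps" using False by (auto simp: h_def)
    define c where "c = (\<lambda>p. if p \<in> set ps
      then the (answer n V (Cut a b p (real h / real n))) else 0)"
    have cut: "a \<le> c p \<and> c p \<le> b \<and> V p {a..c p} = real h / real n" if p: "p \<in> set ps" for p
    proof -
      have "real h / real n \<le> real (length ps) / real n"
        using h by (intro divide_right_mono) auto
      also have "\<dots> \<le> V p {a..b}" using Suc.prems p by auto
      finally have "real h / real n \<le> V p {a..b}" .
      then obtain z where "answer n V (Cut a b p (real h / real n)) = Some z" "a \<le> z" "z \<le> b"
        "V p {a..z} = real h / real n"
        using answer_Cut[of V p a b n "real h / real n"] V Suc.prems p by auto
      then show ?thesis using p by (simp add: c_def)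
    qed
    define qs where "qs = sort_key c ps"
    define z where "z = c (qs ! (h - 1))"
    have qs: "distinct qs" "set qs = set ps" "length qs = length ps"
      using Suc.prems by (auto simp: qs_def)
    have "qs ! (h - 1) \<in> set ps" using h qs by (metis Suc_diff_1 Suc_le_eq nth_mem)
    then have z: "a \<le> z" "z \<le> b" using cut by (auto simp: z_def)
    \<comment> \<open>The first \<open>h\<close> players cut at or before \<open>z\<close>, so each
      of them sees at least \<open>h / n\<close> to its left.\<close>
    have left: "real (length (take h qs)) / real n \<le> V p {a..z}" if p: "p \<in> set (take h qs)" for p
    proof -
      have "p \<in> set ps" using p qs in_set_takeD by fastforce
      moreover have "c p \<le> z"
        using sort_key_split(1)[OF h, of p c] p by (simp add: z_def qs_def)
      ultimately have "V p {a..c p} \<le> V p {a..z}"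
        using V Suc.prems z by (intro value_function_mono) auto
      then show ?thesis using cut[OF \<open>p \<in> set ps\<close>] h qs by simp
    qed
    \<comment> \<open>The others cut at or after \<open>z\<close>, so each of them loses at most
      \<open>h / n\<close> to the left side.\<close>
    have right: "real (length (drop h qs)) / real n \<le> V p {z..b}" if p: "p \<in> set (drop h qs)" for p
    proof -
      have pps: "p \<in> set ps" using p qs in_set_dropD by fastforce
      have Vp: "value_function (V p)" using V Suc.prems pps by auto
      have "p \<in> set (drop (h - 1) qs)"
        using p set_drop_subset_set_drop[of "h - 1" h qs] by auto
      then have "z \<le> c p"
        using sort_key_split(2)[OF h, of p c] by (simp add: z_def qs_def)
      then have "V p {a..z} \<le> V p {a..c p}"
        using Vp Suc.prems cut[OF pps] by (intro value_function_mono) auto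
      moreover have "V p {a..b} = V p {a..z} + V p {z..b}"
        using value_function_split[OF Vp, of a z b] value_function_half_open[OF Vp, of z b]
          Suc.prems z by simp
      moreover have "real (length (drop h qs)) / real n = real (length ps) / real n - real h / real n"
        using h qs by (simp add: of_nat_diff diff_divide_distrib)
      ultimately show ?thesis using cut[OF pps] Suc.prems pps by force
    qed
    have "\<exists>R e. e \<le> d * length (take h qs) \<and> serves n V (set (take h qs)) a z R \<and>
      (\<forall>k::allocation \<Rightarrow> 'a rw. run n V (even_paz d n (take h qs) a z k) = map_pmf (apsnd ((+) e)) (run n V (k R)))"
      using Suc.prems z left qs h set_take_subset[of h qs]
      by (intro Suc.IH) (auto simp: h_def)
    then obtain R e where R: "e \<le> d * h" "serves n V (set (take h qs)) a z R"
      "\<And>k::allocation \<Rightarrow> 'a rw. run n V (even_paz d n (take h qs) a z k) = map_pmf (apsnd ((+) e)) (run n V (k R))"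
      using h qs by auto
    have "\<exists>R e. e \<le> d * length (drop h qs) \<and> serves n V (set (drop h qs)) z b R \<and>
      (\<forall>k::allocation \<Rightarrow> 'a rw. run n V (even_paz d n (drop h qs) z b k) = map_pmf (apsnd ((+) e)) (run n V (k R)))"
      using Suc.prems z right qs h set_drop_subset[of h qs]
      by (intro Suc.IH) (auto simp: h_def)
    then obtain R' e' where R': "e' \<le> d * (length ps - h)" "serves n V (set (drop h qs)) z b R'"
      "\<And>k::allocation \<Rightarrow> 'a rw. run n V (even_paz d n (drop h qs) z b k) = map_pmf (apsnd ((+) e')) (run n V (k R'))"
      using h qs by auto
    have "set (take h qs) \<union> set (drop h qs) = set ps"
      by (metis append_take_drop_id set_append qs(2))
    then have "serves n V (set ps) a b (R ++ R')"
      using serves_merge[OF R(2) R'(2)] z by simp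
    \<comment> \<open>One cut per player on this level, and at most \<open>d\<close> per player in
      the two halves together.\<close>
    moreover have "length ps + e + e' \<le> Suc d * length ps"
    proof -
      have "e + e' \<le> d * (h + (length ps - h))" using R(1) R'(1) by (simp add: distrib_left)
      then show ?thesis using h by simp
    qed
    moreover have "run n V (even_paz (Suc d) n ps a b k)
        = map_pmf (apsnd ((+) (length ps + e + e'))) (run n V (k (R ++ R')))"
      for k :: "allocation \<Rightarrow> 'a rw"
    proof -
      have "run n V (even_paz (Suc d) n ps a b k) = run n V (ask ps (\<lambda>p. Cut a b p (real h / real n)) (\<lambda>c.
         even_paz d n (take h (sort_key c ps)) a (c (sort_key c ps ! (h - 1))) (\<lambda>R.
         even_paz d n (drop h (sort_key c ps)) (c (sort_key c ps ! (h - 1))) b (\<lambda>R'. k (R ++ R')))))"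
        using False by (simp only: even_paz.simps Let_def h_def if_False)
      also have "\<dots> = map_pmf (apsnd ((+) (length ps))) (run n V
         (even_paz d n (take h qs) a z (\<lambda>R. even_paz d n (drop h qs) z b (\<lambda>R'. k (R ++ R')))))"
        by (simp only: run_ask qs_def z_def) (simp only: c_def)
      also have "\<dots> = map_pmf (apsnd ((+) (length ps + e + e'))) (run n V (k (R ++ R')))"
        by (simp add: R(3) R'(3) pmf.map_comp o_def)
           (simp add: apsnd_def map_prod_def case_prod_unfold add.assoc)
      finally show ?thesis .
    qed
    ultimately show ?thesis by blast
  qed
qed

subsection \<open>Independent draws\<close>

lemma finite_set_replicate_pmf:
  "finite (set_pmf p) \<Longrightarrow> finite (set_pmf (replicate_pmf n p))"
  by (induction n) auto

lemma expectation_replicate_pmf_Suc: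
  fixes f :: "'a list \<Rightarrow> real"
  assumes "finite (set_pmf p)"
  shows "measure_pmf.expectation (replicate_pmf (Suc n) p) f =
    measure_pmf.expectation p (\<lambda>x. measure_pmf.expectation (replicate_pmf n p) (\<lambda>xs. f (x # xs)))"
proof -
  have "replicate_pmf (Suc n) p = p \<bind> (\<lambda>x. map_pmf ((#) x) (replicate_pmf n p))"
    by (simp add: map_pmf_def)
  then show ?thesis
    using assms finite_set_replicate_pmf[OF assms, of n]
    by (simp add: pmf_expectation_bind[of "set_pmf p"] integral_measure_pmf[of "set_pmf p" p] del: replicate_pmf.simps)
qed

lemma expectation_swap:
  fixes f :: "'a \<Rightarrow> 'b \<Rightarrow> real"
  assumes "finite (set_pmf p)" "finite (set_pmf q)"
  shows "measure_pmf.expectation p (\<lambda>x. measure_pmf.expectation q (f x))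
    = measure_pmf.expectation q (\<lambda>y. measure_pmf.expectation p (\<lambda>x. f x y))"
  using assms
  by (simp add: integral_measure_pmf[of "set_pmf p"] integral_measure_pmf[of "set_pmf q"]
      sum_distrib_left sum.swap[of _ "set_pmf p"] mult.left_commute)

text \<open>A bounded-differences (Efron--Stein type) estimate: every independent draw contributes
  at most 1 to the variance. The induction conditions on the first draw, whose conditional mean is
  \<open>g\<close>.\<close>

lemma variance_replicate_pmf_le:
  fixes f :: "'a list \<Rightarrow> real"
  assumes "finite (set_pmf p)"
    and "\<And>xs x y ys. length xs + length ys + 1 = n \<Longrightarrow> \<bar>f (xs @ x # ys) - f (xs @ y # ys)\<bar> \<le> 1"
  shows "measure_pmf.variance (replicate_pmf n p) f \<le> real n"
  using assms(2)
proof (induction n arbitrary: f)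
  case 0
  then show ?case by simp
next
  case (Suc n)
  define E :: "('a list \<Rightarrow> real) \<Rightarrow> real" where "E = measure_pmf.expectation (replicate_pmf n p)"
  define g where "g x = E (\<lambda>xs. f (x # xs))" for x
  define \<mu> where "\<mu> = measure_pmf.expectation (replicate_pmf (Suc n) p) f"
  have int [simp]: "integrable (measure_pmf p) h" "integrable (measure_pmf (replicate_pmf n p)) h'"
    for h :: "'a \<Rightarrow> real" and h' :: "'a list \<Rightarrow> real"
    using assms(1) finite_set_replicate_pmf by (auto intro: integrable_measure_pmf_finite)
  have \<mu>: "\<mu> = measure_pmf.expectation p g"
    unfolding \<mu>_def g_def E_def by (rule expectation_replicate_pmf_Suc[OF assms(1)])
  \<comment> \<open>Conditional variance plus squared bias: the cross term vanishes because
    \<open>g x\<close> is the mean of \<open>f (x # xs)\<close> over \<open>xs\<close>.\<close>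
  have inner: "E (\<lambda>xs. (f (x # xs) - \<mu>)\<^sup>2) \<le> real n + (g x - \<mu>)\<^sup>2" for x
  proof -
    have "E (\<lambda>xs. (f (x # xs) - g x)\<^sup>2) \<le> real n"
      unfolding E_def g_def
      using Suc.prems[of "x # _"] by (intro Suc.IH) (auto simp del: append_Cons simp flip: append_Cons)
    moreover have "E (\<lambda>xs. (f (x # xs) - \<mu>)\<^sup>2)
        = E (\<lambda>xs. (f (x # xs) - g x)\<^sup>2 + 2 * (g x - \<mu>) * (f (x # xs) - g x) + (g x - \<mu>)\<^sup>2)"
      by (intro arg_cong[where f = E]) (auto simp: power2_eq_square algebra_simps)
    moreover have "\<dots> = E (\<lambda>xs. (f (x # xs) - g x)\<^sup>2) + 2 * (g x - \<mu>) * (E (\<lambda>xs. f (x # xs)) - g x) + (g x - \<mu>)\<^sup>2"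
      by (simp add: E_def)
    ultimately show ?thesis by (simp add: g_def)
  qed
  have lip: "\<bar>g x - g y\<bar> \<le> 1" for x y
  proof -
    have "\<bar>g x - g y\<bar> = \<bar>E (\<lambda>xs. f (x # xs) - f (y # xs))\<bar>" by (simp add: g_def E_def)
    also have "\<dots> \<le> E (\<lambda>xs. \<bar>f (x # xs) - f (y # xs)\<bar>)" unfolding E_def by (rule integral_abs_bound)
    also have "\<dots> \<le> E (\<lambda>_. 1)" unfolding E_def
      using Suc.prems[of "[]"]
      by (intro integral_mono_AE) (auto simp: AE_measure_pmf_iff set_replicate_pmf)
    finally show ?thesis by (simp add: E_def)
  qed
  \<comment> \<open>\<open>\<mu>\<close> is an average of values of \<open>g\<close>, and any two of
    these differ by at most 1.\<close>
  have close: "(g x - \<mu>)\<^sup>2 \<le> 1" for x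
  proof -
    have "\<bar>g x - \<mu>\<bar> = \<bar>measure_pmf.expectation p (\<lambda>y. g x - g y)\<bar>" by (simp add: \<mu>)
    also have "\<dots> \<le> measure_pmf.expectation p (\<lambda>y. \<bar>g x - g y\<bar>)" by (rule integral_abs_bound)
    also have "\<dots> \<le> measure_pmf.expectation p (\<lambda>_. 1)" by (intro integral_mono) (auto simp: lip)
    finally show ?thesis by (simp add: abs_square_le_1)
  qed
  have "measure_pmf.variance (replicate_pmf (Suc n) p) f
      = measure_pmf.expectation p (\<lambda>x. E (\<lambda>xs. (f (x # xs) - \<mu>)\<^sup>2))"
    unfolding \<mu>_def[symmetric] E_def by (rule expectation_replicate_pmf_Suc[OF assms(1)])
  also have "\<dots> \<le> measure_pmf.expectation p (\<lambda>x. real n + 1)"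
    using order_trans[OF inner add_left_mono[OF close]] by (intro integral_mono) auto
  finally show ?case by simp
qed

lemma map_nth_replicate_pmf:
  "j < n \<Longrightarrow> map_pmf (\<lambda>xs. xs ! j) (replicate_pmf n p) = p"
proof (induction n arbitrary: j)
  case (Suc n)
  show ?case
  proof (cases j)
    case 0
    then show ?thesis by (simp add: map_bind_pmf bind_return_pmf')
  next
    case (Suc i)
    then have "map_pmf (\<lambda>xs. xs ! i) (replicate_pmf n p) = p" using Suc.IH Suc.prems by simp
    then show ?thesis using Suc by (simp add: map_pmf_def bind_assoc_pmf bind_return_pmf)
  qed
qed simp

text \<open>Supplies the joint law of the two picks that may be in conflict.\<close>

lemma map_nth_nth_replicate_pmf:
  "j < k \<Longrightarrow> k < n \<Longrightarrow> map_pmf (\<lambda>xs. (xs ! j, xs ! k)) (replicate_pmf n p) = pair_pmf p p"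
proof (induction n arbitrary: j k)
  case (Suc n)
  obtain l where k: "k = Suc l" "l < n" using Suc.prems by (cases k) auto
  show ?case
  proof (cases j)
    case 0
    have "map_pmf (\<lambda>xs. (xs ! j, xs ! k)) (replicate_pmf (Suc n) p)
        = p \<bind> (\<lambda>x. map_pmf (Pair x) (map_pmf (\<lambda>xs. xs ! l) (replicate_pmf n p)))"
      using 0 k by (simp add: map_bind_pmf map_pmf_def bind_assoc_pmf bind_return_pmf)
    then show ?thesis
      using map_nth_replicate_pmf[of l n p] k by (simp add: pair_pmf_def map_pmf_def)
  next
    case (Suc i)
    then have "map_pmf (\<lambda>xs. (xs ! i, xs ! l)) (replicate_pmf n p) = pair_pmf p p"
      using Suc.IH[of i l] Suc.prems k by simp
    then show ?thesis using Suc k by (simp add: map_pmf_def bind_assoc_pmf bind_return_pmf)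
  qed
qed simp

lemma prob_all_replicate_pmf:
  fixes p :: "'a :: countable pmf"
  shows "measure_pmf.prob (replicate_pmf n p) {xs. \<forall>x\<in>set xs. x \<in> A} = measure_pmf.prob p A ^ n"
proof (induction n)
  case (Suc n)
  have eq: "replicate_pmf (Suc n) p = map_pmf (\<lambda>(x, xs). x # xs) (pair_pmf p (replicate_pmf n p))"
    by (simp add: pair_pmf_def map_bind_pmf)
  have "(\<lambda>(x, xs). x # xs) -` {xs. \<forall>x\<in>set xs. x \<in> A} = A \<times> {xs. \<forall>x\<in>set xs. x \<in> A}" by auto
  then show ?case
    by (simp add: eq Suc.IH measure_pmf_prob_product countableI_type del: replicate_pmf.simps)
qed simp

text \<open>The weight \<open>2^{-c}\<close>, where \<open>c\<close> is the number of distinct hits so far, shrinks in expectation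
  with every draw as long as at least the fraction \<open>\<delta>\<close> of the population are hits still missing.\<close>

lemma prob_few_distinct_hits:
  assumes "finite L" "L \<subseteq> {..<n}" "\<delta> * real n \<le> real (card L) - real s" "0 \<le> \<delta>" "0 < n"
  shows "measure_pmf.prob (replicate_pmf N (pmf_of_set {..<n})) {xs. card (L \<inter> set xs) < s}
    \<le> 2 ^ s * (1 - \<delta> / 2) ^ N"
proof -
  define p where "p = pmf_of_set {..<n}"
  \<comment> \<open>The weight is cut off to 0 at \<open>s\<close> hits, since from there on the
    missing hits may be less than the fraction \<delta> of the population.\<close>
  define w :: "nat list \<Rightarrow> real"
    where "w xs = (if card (L \<inter> set xs) < s then (1 / 2) ^ card (L \<inter> set xs) else 0)" for xs
  have set_p: "set_pmf p = {..<n}" unfolding p_def using assms(5) by (intro set_pmf_of_set) auto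
  then have fin: "finite (set_pmf p)" by simp
  have int: "integrable (measure_pmf p) h" "integrable (measure_pmf (replicate_pmf N p)) h'"
    for h :: "nat \<Rightarrow> real" and h' :: "nat list \<Rightarrow> real" and N
    using fin finite_set_replicate_pmf by (auto intro: integrable_measure_pmf_finite)
  have step: "measure_pmf.expectation p (\<lambda>x. w (x # xs)) \<le> (1 - \<delta> / 2) * w xs" for xs
  proof (cases "card (L \<inter> set xs) < s")
    case False
    have "card (L \<inter> set xs) \<le> card (L \<inter> set (x # xs))" for x
      using assms(1) by (intro card_mono) auto
    then have "\<not> card (L \<inter> set (x # xs)) < s" for x using False by (meson le_less_trans)
    then have "w (x # xs) = 0" for x by (simp only: w_def if_False)
    then show ?thesis using False by (simp add: w_def)
  next
    case True
    define M where "M = L - set xs"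
    \<comment> \<open>A draw from \<open>M\<close> is a new hit: it halves the weight or, on
      reaching \<open>s\<close> hits, removes it.\<close>
    have bound: "w (x # xs) \<le> w xs * (1 - indicator M x / 2)" for x
    proof (cases "x \<in> M")
      case x: True
      then have "L \<inter> set (x # xs) = insert x (L \<inter> set xs)" "x \<notin> L \<inter> set xs" by (auto simp: M_def)
      then have "card (L \<inter> set (x # xs)) = Suc (card (L \<inter> set xs))" using assms(1) by simp
      then show ?thesis using x True by (simp add: w_def)
    next
      case x: False
      then have "L \<inter> set (x # xs) = L \<inter> set xs" by (auto simp: M_def)
      then show ?thesis using x by (simp add: w_def)
    qed
    have "card M = card L - card (L \<inter> set xs)"
      unfolding M_def using assms(1) by (simp add: card_Diff_subset_Int)
    then have "\<delta> * real n \<le> real (card M)" using assms(3) True by linarith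
    moreover have "measure_pmf.prob p M = real (card M) / real n"
      unfolding p_def using assms(2,5) by (subst measure_pmf_of_set) (auto simp: M_def intro!: arg_cong[where f = card])
    ultimately have M: "\<delta> \<le> measure_pmf.prob p M" using assms(5) by (simp add: pos_le_divide_eq)
    have "measure_pmf.expectation p (\<lambda>x. w (x # xs))
        \<le> measure_pmf.expectation p (\<lambda>x. w xs * (1 - indicator M x / 2))"
      using bound by (intro integral_mono int) auto
    also have "\<dots> = w xs * (1 - measure_pmf.prob p M / 2)"
      using int by simp
    also have "\<dots> \<le> w xs * (1 - \<delta> / 2)"
      using M by (intro mult_left_mono) (auto simp: w_def)
    finally show ?thesis by (simp add: mult.commute)
  qed
  have "\<delta> \<le> 1"
  proof -
    have "card L \<le> n" using card_mono[OF _ assms(2)] by simp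
    then have "\<delta> * real n \<le> 1 * real n" using assms(3) by linarith
    then show ?thesis using assms(5) by simp
  qed
  have total: "measure_pmf.expectation (replicate_pmf N p) w \<le> (1 - \<delta> / 2) ^ N" for N
  proof (induction N)
    case 0
    then show ?case by (simp add: w_def)
  next
    case (Suc N)
    \<comment> \<open>The swap makes the head draw the innermost one, so that \<open>step\<close>
      applies for each fixed tail.\<close>
    have "measure_pmf.expectation (replicate_pmf (Suc N) p) w
        = measure_pmf.expectation (replicate_pmf N p) (\<lambda>xs. measure_pmf.expectation p (\<lambda>x. w (x # xs)))"
      unfolding expectation_replicate_pmf_Suc[OF fin]
      by (rule expectation_swap[OF fin finite_set_replicate_pmf[OF fin]])
    also have "\<dots> \<le> measure_pmf.expectation (replicate_pmf N p) (\<lambda>xs. (1 - \<delta> / 2) * w xs)"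
      using step by (intro integral_mono int) auto
    also have "\<dots> \<le> (1 - \<delta> / 2) * (1 - \<delta> / 2) ^ N"
      using Suc.IH \<open>\<delta> \<le> 1\<close> int by (simp add: mult_left_mono)
    finally show ?case by simp
  qed
  have "measure_pmf.prob (replicate_pmf N p) {xs. card (L \<inter> set xs) < s}
      = measure_pmf.expectation (replicate_pmf N p) (indicator {xs. card (L \<inter> set xs) < s})"
    by simp
  also have "\<dots> \<le> measure_pmf.expectation (replicate_pmf N p) (\<lambda>xs. 2 ^ s * w xs)"
  proof (intro integral_mono int)
    fix xs
    \<comment> \<open>Markov's inequality: with fewer than \<open>s\<close> hits the weight is at
      least \<open>2 ^ (- s)\<close>.\<close>
    have "1 \<le> 2 ^ s * w xs" if "card (L \<inter> set xs) < s"
      using that by (simp add: w_def power_one_over divide_simps power_increasing)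
    then show "indicator {xs. card (L \<inter> set xs) < s} xs \<le> 2 ^ s * w xs"
      by (auto simp: indicator_def w_def)
  qed
  also have "\<dots> \<le> 2 ^ s * (1 - \<delta> / 2) ^ N" using total[of N] int by simp
  finally show ?thesis by (simp add: p_def)
qed

subsection \<open>Disjoint pieces among random pieces\<close>

text \<open>The independence number of the intersection graph of the first \<open>s\<close> sets. An
  empty set counts as a vertex without neighbours.\<close>

definition packing_number :: "nat \<Rightarrow> (nat \<Rightarrow> 'b set) \<Rightarrow> nat" where
  "packing_number s I = Max (card ` {T. T \<subseteq> {..<s} \<and> disjoint_family_on I T})"

lemma finite_packings: "finite {T. T \<subseteq> {..<s::nat} \<and> disjoint_family_on I T}"
  by (rule finite_subset[of _ "Pow {..<s}"]) auto

lemma packing_number_cong: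
  assumes "\<And>j. j < s \<Longrightarrow> I j = I' j"
  shows "packing_number s I = packing_number s I'"
proof -
  have "disjoint_family_on I T = disjoint_family_on I' T" if "T \<subseteq> {..<s}" for T
    using assms that unfolding disjoint_family_on_def by (metis lessThan_iff subsetD)
  then have "{T. T \<subseteq> {..<s} \<and> disjoint_family_on I T} = {T. T \<subseteq> {..<s} \<and> disjoint_family_on I' T}"
    by blast
  then show ?thesis by (simp only: packing_number_def)
qed

lemma packing_number_ge:
  "T \<subseteq> {..<s} \<Longrightarrow> disjoint_family_on I T \<Longrightarrow> card T \<le> packing_number s I"
  unfolding packing_number_def using finite_packings by (intro Max_ge) auto

lemma packing_number_witness:
  obtains T where "T \<subseteq> {..<s}" "disjoint_family_on I T" "card T = packing_number s I"
proof -
  have "{} \<in> {T. T \<subseteq> {..<s} \<and> disjoint_family_on I T}" by (auto simp: disjoint_family_on_def)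
  then have "packing_number s I \<in> card ` {T. T \<subseteq> {..<s} \<and> disjoint_family_on I T}"
    unfolding packing_number_def using finite_packings by (intro Max_in) auto
  then show ?thesis using that by auto
qed

text \<open>Deleting the changed index \<open>k\<close> from an optimal packing for \<open>I\<close>
  leaves a packing for \<open>I'\<close>. This is the bounded difference that the variance estimate
  needs.\<close>

lemma packing_number_change:
  assumes "\<And>j. j < s \<Longrightarrow> j \<noteq> k \<Longrightarrow> I j = I' j"
  shows "packing_number s I \<le> packing_number s I' + 1"
proof -
  obtain T where T: "T \<subseteq> {..<s}" "disjoint_family_on I T" "card T = packing_number s I"
    by (rule packing_number_witness)
  have "disjoint_family_on I' (T - {k})"
    unfolding disjoint_family_on_def
  proof (intro ballI impI)
    fix i j assume ij: "i \<in> T - {k}" "j \<in> T - {k}" "i \<noteq> j"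
    then have "I i \<inter> I j = {}" using T(2) by (auto simp: disjoint_family_on_def)
    moreover have "I i = I' i" "I j = I' j" using assms ij T(1) by auto
    ultimately show "I' i \<inter> I' j = {}" by simp
  qed
  then have "card (T - {k}) \<le> packing_number s I'" using T(1) by (intro packing_number_ge) auto
  then show ?thesis using T(3) diff_card_le_card_Diff[of "{k}" T] by simp
qed

text \<open>Drop the larger index of every conflicting pair.\<close>

lemma packing_number_conflicts:
  "s \<le> packing_number s I + card {(j, k). j < k \<and> k < s \<and> I j \<inter> I k \<noteq> {}}"
proof -
  let ?C = "{(j, k). j < k \<and> k < s \<and> I j \<inter> I k \<noteq> {}}"
  have fin: "finite ?C" by (rule finite_subset[of _ "{..<s} \<times> {..<s}"]) auto
  let ?T = "{..<s} - snd ` ?C"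
  have *: "I j \<inter> I k = {}" if "j \<in> ?T" "k \<in> ?T" "j < k" for j k
  proof (rule ccontr)
    assume "I j \<inter> I k \<noteq> {}"
    then have "(j, k) \<in> ?C" using that by auto
    then show False using that(2) by force
  qed
  then have "disjoint_family_on I ?T"
    unfolding disjoint_family_on_def
  proof (intro ballI impI)
    fix j k assume "j \<in> ?T" "k \<in> ?T" "j \<noteq> k"
    then show "I j \<inter> I k = {}" using *[of j k] *[of k j] by (cases "j < k") (simp_all add: Int_commute)
  qed
  then have "card ?T \<le> packing_number s I" by (intro packing_number_ge) auto
  moreover have "s - card (snd ` ?C) \<le> card ?T"
    using diff_card_le_card_Diff[of "snd ` ?C" "{..<s}"] fin by simp
  moreover have "card (snd ` ?C) \<le> card ?C" using fin by (rule card_image_le)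
  ultimately show ?thesis by linarith
qed

section \<open>Overlaps between two subdivisions\<close>

lemma card_left_end_in:
  fixes a b :: "nat \<Rightarrow> 'b :: linorder"
  assumes "\<And>i j. i \<le> j \<Longrightarrow> j \<le> M \<Longrightarrow> b i \<le> b j"
  shows "card {(i, j). i < M \<and> j < M \<and> b j \<le> a i \<and> a i < b (Suc j)} \<le> M"
proof -
  let ?X = "{(i, j). i < M \<and> j < M \<and> b j \<le> a i \<and> a i < b (Suc j)}"
  \<comment> \<open>The cells from \<open>b j\<close> up to but excluding \<open>b (Suc j)\<close>
    are disjoint, so \<open>a i\<close> lies in at most one of them and a pair in \<open>?X\<close>
    is determined by its first component.\<close>
  have False if "j < j'" "j' < M" "b j' \<le> a i" "a i < b (Suc j)" for i j j'
    using assms[of "Suc j" j'] that by auto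
  then have "inj_on fst ?X"
    by (auto intro!: inj_onI) (metis linorder_neqE_nat)
  then have "card ?X \<le> card {..<M}" by (rule card_inj_on_le) auto
  then show ?thesis by simp
qed

text \<open>The intersection of two half-open intervals starts at the left end of one of them.\<close>

lemma card_overlaps:
  fixes a b :: "nat \<Rightarrow> 'b :: linorder"
  assumes "\<And>i j. i \<le> j \<Longrightarrow> j \<le> M \<Longrightarrow> a i \<le> a j" "\<And>i j. i \<le> j \<Longrightarrow> j \<le> M \<Longrightarrow> b i \<le> b j"
  shows "card {(i, j). i < M \<and> j < M \<and> {a i<..a (Suc i)} \<inter> {b j<..b (Suc j)} \<noteq> {}} \<le> 2 * M"
proof -
  let ?X = "{(i, j). i < M \<and> j < M \<and> b j \<le> a i \<and> a i < b (Suc j)}"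
  let ?Y = "{(j, i). j < M \<and> i < M \<and> a i \<le> b j \<and> b j < a (Suc i)}"
  have fin: "finite ?X" "finite ?Y"
    by (rule finite_subset[of _ "{..<M} \<times> {..<M}"]; auto)+
  have "{(i, j). i < M \<and> j < M \<and> {a i<..a (Suc i)} \<inter> {b j<..b (Suc j)} \<noteq> {}} \<subseteq> ?X \<union> prod.swap ` ?Y"
  proof (rule subsetI)
    fix c assume "c \<in> {(i, j). i < M \<and> j < M \<and> {a i<..a (Suc i)} \<inter> {b j<..b (Suc j)} \<noteq> {}}"
    then obtain i j where c: "c = (i, j)"
      and *: "i < M" "j < M" "{a i<..a (Suc i)} \<inter> {b j<..b (Suc j)} \<noteq> {}" by auto
    then obtain x where "x \<in> {a i<..a (Suc i)}" "x \<in> {b j<..b (Suc j)}" by blast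
    then have "(i, j) \<in> ?X \<or> (j, i) \<in> ?Y" using *(1,2) by auto
    then show "c \<in> ?X \<union> prod.swap ` ?Y" unfolding c by force
  qed
  then have "card {(i, j). i < M \<and> j < M \<and> {a i<..a (Suc i)} \<inter> {b j<..b (Suc j)} \<noteq> {}}
      \<le> card (?X \<union> prod.swap ` ?Y)"
    using fin by (intro card_mono) auto
  also have "\<dots> \<le> card ?X + card (prod.swap ` ?Y)" by (rule card_Un_le)
  also have "\<dots> \<le> M + M"
    using card_left_end_in[of M b a] card_left_end_in[of M a b] assms card_image_le[OF fin(2), of prod.swap]
    by (intro add_mono) auto
  finally show ?thesis by simp
qed

text \<open>At most \<open>2 * M\<close> of the \<open>M * M\<close> equally likely pairs of pieces
  overlap.\<close>

lemma prob_overlap_le: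
  fixes a b :: "nat \<Rightarrow> 'b :: linorder"
  assumes "\<And>i j. i \<le> j \<Longrightarrow> j \<le> M \<Longrightarrow> a i \<le> a j" "\<And>i j. i \<le> j \<Longrightarrow> j \<le> M \<Longrightarrow> b i \<le> b j" "0 < M"
  shows "measure_pmf.prob (pair_pmf (pmf_of_set {..<M}) (pmf_of_set {..<M}))
    {(i, j). {a i<..a (Suc i)} \<inter> {b j<..b (Suc j)} \<noteq> {}} \<le> 2 / real M"
proof -
  have "measure_pmf.prob (pair_pmf (pmf_of_set {..<M}) (pmf_of_set {..<M}))
      {(i, j). {a i<..a (Suc i)} \<inter> {b j<..b (Suc j)} \<noteq> {}}
    = real (card (({..<M} \<times> {..<M}) \<inter> {(i, j). {a i<..a (Suc i)} \<inter> {b j<..b (Suc j)} \<noteq> {}}))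
      / real (card ({..<M} \<times> {..<M}))"
  proof -
    have "pair_pmf (pmf_of_set {..<M}) (pmf_of_set {..<M}) = pmf_of_set ({..<M} \<times> {..<M})"
      using assms(3)
      by (intro pmf_eqI) (auto simp: pmf_pair pmf_of_set indicator_def lessThan_empty_iff split: prod.splits)
    then show ?thesis using assms(3) by (simp add: measure_pmf_of_set lessThan_empty_iff)
  qed
  also have "({..<M} \<times> {..<M}) \<inter> {(i, j). {a i<..a (Suc i)} \<inter> {b j<..b (Suc j)} \<noteq> {}}
    = {(i, j). i < M \<and> j < M \<and> {a i<..a (Suc i)} \<inter> {b j<..b (Suc j)} \<noteq> {}}" by auto
  also have "real (card \<dots>) \<le> real (2 * M)"
    using card_overlaps[OF assms(1,2)] by (intro of_nat_mono) auto
  finally show ?thesis using assms(3) by (simp add: divide_right_mono field_simps)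
qed

section \<open>Random picks from \<open>s\<close> monotone subdivisions into \<open>M\<close>
  pieces\<close>

context
  fixes a :: "nat \<Rightarrow> nat \<Rightarrow> 'b :: linorder" and s M :: nat
  assumes marks_mono: "\<And>p i j. p < s \<Longrightarrow> i \<le> j \<Longrightarrow> j \<le> M \<Longrightarrow> a p i \<le> a p j"
    and M_pos: "0 < M"
begin

text \<open>Linearity of expectation over at most \<open>s * s / 2\<close> index pairs, each of
  which is in conflict with probability at most \<open>2 / M\<close>.\<close>

lemma expectation_packing_number:
  "real s - (real s)\<^sup>2 / real M \<le> measure_pmf.expectation (replicate_pmf s (pmf_of_set {..<M}))
     (\<lambda>is. real (packing_number s (\<lambda>p. {a p (is ! p)<..a p (Suc (is ! p))})))"
    (is "_ \<le> measure_pmf.expectation ?D ?f")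
proof -
  let ?C = "{(j, k). j < k \<and> k < s}"
  let ?conf = "\<lambda>(j, k). {is. {a j (is ! j)<..a j (Suc (is ! j))} \<inter> {a k (is ! k)<..a k (Suc (is ! k))} \<noteq> {}}"
  have finC: "finite ?C" by (rule finite_subset[of _ "{..<s} \<times> {..<s}"]) auto
  have "finite (set_pmf (pmf_of_set {..<M}))" using M_pos by (subst set_pmf_of_set) auto
  then have int: "integrable (measure_pmf ?D) h" for h :: "nat list \<Rightarrow> real"
    by (intro integrable_measure_pmf_finite finite_set_replicate_pmf)
  have card: "real (card {(j, k). j < k \<and> k < s \<and> {a j (is ! j)<..a j (Suc (is ! j))}
      \<inter> {a k (is ! k)<..a k (Suc (is ! k))} \<noteq> {}}) = (\<Sum>c\<in>?C. indicator (?conf c) is)" for "is"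
  proof -
    have "{(j, k). j < k \<and> k < s \<and> {a j (is ! j)<..a j (Suc (is ! j))}
      \<inter> {a k (is ! k)<..a k (Suc (is ! k))} \<noteq> {}} = {c \<in> ?C. is \<in> ?conf c}" by auto
    then show ?thesis using finC by (simp add: indicator_def sum.If_cases Int_def)
  qed
  have prob: "measure_pmf.prob ?D (?conf c) \<le> 2 / real M" if in_C: "c \<in> ?C" for c
  proof -
    obtain j k where c: "c = (j, k)" "j < k" "k < s" using in_C by auto
    have "measure_pmf.prob ?D (?conf c) = measure_pmf.prob (map_pmf (\<lambda>is. (is ! j, is ! k)) ?D)
        {(i, i'). {a j i<..a j (Suc i)} \<inter> {a k i'<..a k (Suc i')} \<noteq> {}}"
      by (simp add: c vimage_def)
    also have "map_pmf (\<lambda>is. (is ! j, is ! k)) ?D = pair_pmf (pmf_of_set {..<M}) (pmf_of_set {..<M})"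
      using c by (intro map_nth_nth_replicate_pmf) auto
    also have "measure_pmf.prob \<dots> {(i, i'). {a j i<..a j (Suc i)} \<inter> {a k i'<..a k (Suc i')} \<noteq> {}} \<le> 2 / real M"
      using c marks_mono M_pos by (intro prob_overlap_le) auto
    finally show ?thesis .
  qed
  \<comment> \<open>The pairs with \<open>j < k\<close> and their mirror images are disjoint inside
    an \<open>s\<close> by \<open>s\<close> square.\<close>
  have cardC: "2 * card ?C \<le> s * s"
  proof -
    have fin: "finite (prod.swap ` ?C)" using finC by simp
    have "card (?C \<union> prod.swap ` ?C) = card ?C + card (prod.swap ` ?C)"
      using finC by (intro card_Un_disjoint) auto
    moreover have "card (prod.swap ` ?C) = card ?C" by (rule card_image) simp
    moreover have "card (?C \<union> prod.swap ` ?C) \<le> card ({..<s} \<times> {..<s})"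
      by (intro card_mono) auto
    ultimately show ?thesis by simp
  qed
  have "real s = measure_pmf.expectation ?D (\<lambda>_. real s)" by simp
  also have "\<dots> \<le> measure_pmf.expectation ?D (\<lambda>is. ?f is + (\<Sum>c\<in>?C. indicator (?conf c) is))"
  proof (intro integral_mono int)
    fix "is"
    show "real s \<le> ?f is + (\<Sum>c\<in>?C. indicator (?conf c) is)"
      unfolding card[symmetric] of_nat_add[symmetric] of_nat_le_iff
      by (rule packing_number_conflicts)
  qed
  also have "\<dots> = measure_pmf.expectation ?D ?f + (\<Sum>c\<in>?C. measure_pmf.prob ?D (?conf c))"
    using int by (simp add: Bochner_Integration.integral_sum)
  also have "(\<Sum>c\<in>?C. measure_pmf.prob ?D (?conf c)) \<le> (\<Sum>c\<in>?C. 2 / real M)"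
    using prob by (intro sum_mono) auto
  also have "\<dots> = real (2 * card ?C) / real M" by simp
  also have "\<dots> \<le> real (s * s) / real M" using cardC by (intro divide_right_mono of_nat_mono) auto
  finally show ?thesis by (simp add: power2_eq_square)
qed

lemma variance_packing_number:
  "measure_pmf.variance (replicate_pmf s (pmf_of_set {..<M}))
     (\<lambda>is. real (packing_number s (\<lambda>p. {a p (is ! p)<..a p (Suc (is ! p))}))) \<le> real s"
proof (rule variance_replicate_pmf_le)
  show "finite (set_pmf (pmf_of_set {..<M}))" using M_pos by (subst set_pmf_of_set) auto
next
  fix xs ys :: "nat list" and x y
  let ?I = "\<lambda>is p. {a p (is ! p)<..a p (Suc (is ! p))}"
  have eq: "(xs @ x # ys) ! p = (xs @ y # ys) ! p" if "p \<noteq> length xs" for p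
    using that by (auto simp: nth_append nth_Cons')
  have "packing_number s (?I (xs @ x # ys)) \<le> packing_number s (?I (xs @ y # ys)) + 1"
    by (rule packing_number_change[of _ "length xs"]) (simp add: eq)
  moreover have "packing_number s (?I (xs @ y # ys)) \<le> packing_number s (?I (xs @ x # ys)) + 1"
    by (rule packing_number_change[of _ "length xs"]) (simp add: eq)
  ultimately show "\<bar>real (packing_number s (?I (xs @ x # ys))) - real (packing_number s (?I (xs @ y # ys)))\<bar> \<le> 1"
    by linarith
qed

text \<open>The expected loss is at most \<open>64 * r / 127 \<le> r\<close>, so the mean is at
  least \<open>7 * r\<close> and a value below \<open>r\<close> deviates by at least
  \<open>6 * r\<close>. Chebyshev gives \<open>8 * r / (6 * r)^2 = 2 / (9 * r)\<close>.\<close>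

lemma prob_packing_number_less:
  assumes "s = 8 * r" "M = 127 * r"
  shows "measure_pmf.prob (replicate_pmf s (pmf_of_set {..<M}))
    {is. packing_number s (\<lambda>p. {a p (is ! p)<..a p (Suc (is ! p))}) < r} \<le> 1 / (4 * real r)"
proof -
  let ?D = "replicate_pmf s (pmf_of_set {..<M})"
  let ?f = "\<lambda>is. real (packing_number s (\<lambda>p. {a p (is ! p)<..a p (Suc (is ! p))}))"
  let ?\<mu> = "measure_pmf.expectation ?D ?f"
  have r: "0 < real r" using M_pos assms by simp
  have "(real s)\<^sup>2 / real M \<le> real r"
    using r by (simp add: assms power2_eq_square field_simps)
  then have \<mu>: "7 * real r \<le> ?\<mu>" using expectation_packing_number by (simp add: assms(1))
  have "finite (set_pmf (pmf_of_set {..<M}))" using M_pos by (subst set_pmf_of_set) auto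
  then have int: "integrable (measure_pmf ?D) h" for h :: "nat list \<Rightarrow> real"
    by (intro integrable_measure_pmf_finite finite_set_replicate_pmf)
  have "measure_pmf.prob ?D {is. packing_number s (\<lambda>p. {a p (is ! p)<..a p (Suc (is ! p))}) < r}
      \<le> measure_pmf.prob ?D {is \<in> space ?D. 6 * real r \<le> \<bar>?f is - ?\<mu>\<bar>}"
  proof (rule measure_pmf.finite_measure_mono)
    show "{is. packing_number s (\<lambda>p. {a p (is ! p)<..a p (Suc (is ! p))}) < r}
      \<subseteq> {is \<in> space ?D. 6 * real r \<le> \<bar>?f is - ?\<mu>\<bar>}"
    proof
      fix "is" assume "is \<in> {is. packing_number s (\<lambda>p. {a p (is ! p)<..a p (Suc (is ! p))}) < r}"
      then have "?f is \<le> real r" by simp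
      then have "6 * real r \<le> \<bar>?f is - ?\<mu>\<bar>" using \<mu> by linarith
      then show "is \<in> {is \<in> space ?D. 6 * real r \<le> \<bar>?f is - ?\<mu>\<bar>}" by simp
    qed
  qed simp
  also have "\<dots> \<le> measure_pmf.variance ?D ?f / (6 * real r)\<^sup>2"
    using r by (intro measure_pmf.Chebyshev_inequality int) auto
  also have "\<dots> \<le> real s / (6 * real r)\<^sup>2"
    by (intro divide_right_mono variance_packing_number) auto
  also have "\<dots> \<le> 1 / (4 * real r)"
    using r by (simp add: assms(1) power2_eq_square field_simps)
  finally show ?thesis .
qed

end

subsection \<open>The two parts of the algorithm\<close>

text \<open>The filter keeps unserved players who value \<open>{x..1}\<close> at
  \<open>1 - \<epsilon>\<close> or more. That is enough for
  \<open>\<lfloor>(1 - \<epsilon>) * n\<rfloor>\<close> shares of \<open>1 / n\<close>, hence the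
  cap imposed by \<open>take\<close>.\<close>

definition completion :: "nat \<Rightarrow> real \<Rightarrow> real \<Rightarrow> player set \<Rightarrow> allocation rw" where
  "completion n \<epsilon> x T = ask [0..<n] (\<lambda>p. Eval 0 1 p x) (\<lambda>v.
     even_paz (nat \<lceil>log 2 (real n)\<rceil>) n
       (take (nat \<lfloor>(1 - \<epsilon>) * real n\<rfloor>) (filter (\<lambda>p. p \<notin> T \<and> v p \<le> \<epsilon>) [0..<n])) x 1 Return)"

text \<open>For the last claim, either the cap is reached and the number of unserved players follows
  by counting, or every kept player is served and only those who value \<open>{0..x}\<close> above
  \<epsilon> can be left over.\<close>

lemma run_completion:
  assumes V: "\<forall>p<n. value_function (V p)"
    and "0 < n" "0 \<le> \<epsilon>" "\<epsilon> \<le> 1" "0 \<le> x" "x \<le> 1" "T \<subseteq> {..<n}" "T \<noteq> {}"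
  obtains R c where "run n V (completion n \<epsilon> x T) = return_pmf (R, c)"
    "c \<le> n + nat \<lceil>log 2 (real n)\<rceil> * n" "serves n V (dom R) x 1 R" "dom R \<subseteq> {..<n} - T"
    "real (card {p. p < n \<and> \<epsilon> < V p {0..x}}) \<le> \<epsilon> * real n \<longrightarrow>
       real (card ({..<n} - T - dom R)) \<le> \<epsilon> * real n"
proof -
  define d where "d = nat \<lceil>log 2 (real n)\<rceil>"
  define v where "v = (\<lambda>p. if p \<in> set [0..<n] then the (answer n V (Eval 0 1 p x)) else 0)"
  have v: "v p = V p {0..x}" if "p < n" for p
    using that assms by (simp add: v_def answer_Eval)
  define goods where "goods = filter (\<lambda>p. p \<notin> T \<and> v p \<le> \<epsilon>) [0..<n]"
  define m where "m = nat \<lfloor>(1 - \<epsilon>) * real n\<rfloor>"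
  define ps where "ps = take m goods"
  have ps: "distinct ps" "set ps \<subseteq> {..<n} - T"
    using set_take_subset[of m goods] by (auto simp: ps_def goods_def)
  have len: "length ps \<le> n"
    using distinct_card[OF ps(1)] card_mono[of "{..<n}" "set ps"] ps(2) by auto
  have pow: "n \<le> 2 ^ d"
  proof -
    have "log 2 (real n) \<le> real d" unfolding d_def by linarith
    then have "real n \<le> 2 powr real d" using assms(2) by (simp add: log_le_iff)
    then show ?thesis by (simp add: powr_realpow)
  qed
  have val: "real (length ps) / real n \<le> V p {x..1}" if p: "p \<in> set ps" for p
  proof -
    have "p \<in> set goods" using p by (auto simp: ps_def dest: in_set_takeD)
    then have "p < n" "V p {0..x} \<le> \<epsilon>" using v by (auto simp: goods_def)
    then have Vp: "value_function (V p)" using V by simp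
    have "real (length ps) \<le> (1 - \<epsilon>) * real n"
    proof -
      have "0 \<le> (1 - \<epsilon>) * real n" using assms(3,4) by simp
      then have "real m \<le> (1 - \<epsilon>) * real n" unfolding m_def by linarith
      then show ?thesis by (simp add: ps_def)
    qed
    then have "real (length ps) / real n \<le> 1 - \<epsilon>" using assms(2) by (simp add: pos_divide_le_eq)
    moreover have "V p {0..1} = V p {0..x} + V p {x..1}"
      using value_function_split[OF Vp, of 0 x 1] value_function_half_open[OF Vp, of x 1] assms by simp
    moreover have "V p {0..1} = 1" using Vp by (simp add: value_function_def cake_def)
    ultimately show ?thesis using \<open>V p {0..x} \<le> \<epsilon>\<close> by linarith
  qed
  have "\<exists>R c. c \<le> d * length ps \<and> serves n V (set ps) x 1 R \<and>
    (\<forall>k :: allocation \<Rightarrow> allocation rw. run n V (even_paz d n ps x 1 k) = map_pmf (apsnd ((+) c)) (run n V (k R)))"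
    using ps len pow val assms by (intro run_even_paz) auto
  then obtain R c where R: "c \<le> d * length ps" "serves n V (set ps) x 1 R"
    "run n V (even_paz d n ps x 1 Return) = return_pmf (R, c)"
    by force
  have dom: "dom R = set ps" using R(2) by (simp add: serves_def)
  have "run n V (completion n \<epsilon> x T) = map_pmf (apsnd ((+) n)) (run n V (even_paz d n ps x 1 Return))"
    unfolding completion_def by (simp only: run_ask length_upt ps_def goods_def d_def m_def) (simp add: v_def)
  then have "run n V (completion n \<epsilon> x T) = return_pmf (R, n + c)" by (simp add: R(3))
  moreover have "n + c \<le> n + d * n" using R(1) mult_le_mono2[OF len, of d] by linarith
  moreover have "real (card ({..<n} - T - dom R)) \<le> \<epsilon> * real n"
    if few: "real (card {p. p < n \<and> \<epsilon> < V p {0..x}}) \<le> \<epsilon> * real n"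
  proof (cases "m \<le> length goods")
    case True
    have finT: "finite T" using assms(7) finite_subset by blast
    have "card ({..<n} - T - dom R) = n - card T - m"
      using True ps assms(7) finT distinct_card[OF ps(1)] unfolding dom
      by (subst card_Diff_subset, simp, blast, subst card_Diff_subset) (auto simp: ps_def)
    \<comment> \<open>The player already served in \<open>T\<close> compensates for rounding down in
      \<open>m\<close>.\<close>
    moreover have "1 \<le> card T" using finT assms(8) by (simp add: Suc_le_eq card_gt_0_iff)
    moreover have "(1 - \<epsilon>) * real n \<le> real m + 1" unfolding m_def by linarith
    moreover have "0 \<le> \<epsilon> * real n" using assms by simp
    ultimately show ?thesis by (simp add: algebra_simps)
  next
    case False
    then have "ps = goods" by (simp add: ps_def)
    then have "{..<n} - T - dom R \<subseteq> {p. p < n \<and> \<epsilon> < V p {0..x}}"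
      using v by (auto simp: dom goods_def not_le)
    then have "card ({..<n} - T - dom R) \<le> card {p. p < n \<and> \<epsilon> < V p {0..x}}"
      by (intro card_mono) auto
    then show ?thesis using few by linarith
  qed
  ultimately show ?thesis using that[of R "n + c"] R(2) dom ps(2) by (simp add: d_def)
qed

section \<open>Marks and the preassigning part\<close>

definition mark :: "nat \<Rightarrow> valuation \<Rightarrow> player \<Rightarrow> real \<Rightarrow> real" where
  "mark n V p \<alpha> = the (answer n V (Cut 0 1 p \<alpha>))"

lemma mark:
  assumes "value_function (V p)" "p < n" "0 \<le> \<alpha>" "\<alpha> \<le> 1"
  shows "0 \<le> mark n V p \<alpha>" "mark n V p \<alpha> \<le> 1" "V p {0..mark n V p \<alpha>} = \<alpha>"
proof -
  have "V p {0..1} = 1" using assms(1) by (simp add: value_function_def cake_def)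
  then obtain z where "answer n V (Cut 0 1 p \<alpha>) = Some z" "0 \<le> z" "z \<le> 1" "V p {0..z} = \<alpha>"
    using answer_Cut[of V p 0 1 n \<alpha>] assms by auto
  then show "0 \<le> mark n V p \<alpha>" "mark n V p \<alpha> \<le> 1" "V p {0..mark n V p \<alpha>} = \<alpha>"
    by (auto simp: mark_def)
qed

lemma mark_mono:
  assumes V: "value_function (V p)" and "p < n" "0 \<le> \<alpha>" "\<alpha> \<le> \<beta>" "\<beta> \<le> 1"
  shows "mark n V p \<alpha> \<le> mark n V p \<beta>"
proof (cases "\<alpha> = \<beta>")
  case False
  show ?thesis
  proof (rule ccontr)
    assume "\<not> ?thesis"
    then have "V p {0..mark n V p \<beta>} \<le> V p {0..mark n V p \<alpha>}"
      using mark(2)[where V = V and p = p and n = n and \<alpha> = \<alpha>] assms by (intro value_function_mono[OF V]) auto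
    then show False
      using mark(3)[where V = V and p = p and n = n] assms False by simp
  qed
qed simp

text \<open>\<open>c (p, i)\<close> stands for the mark of player \<open>p\<close> at value
  \<open>i / n\<close>, and \<open>is\<close> holds one picked index for each player in
  \<open>ps\<close>.\<close>

definition offer :: "(player \<times> nat \<Rightarrow> real) \<Rightarrow> player list \<Rightarrow> nat list \<Rightarrow> allocation" where
  "offer c ps is = map_of (map2 (\<lambda>p i. (p, {{c (p, i)<..c (p, Suc i)}})) ps is)"

lemma offer_SomeD:
  assumes "offer c ps is p = Some C"
  obtains i where "(p, i) \<in> set (zip ps is)" "C = {{c (p, i)<..c (p, Suc i)}}"
proof -
  have "(p, C) \<in> set (map2 (\<lambda>p i. (p, {{c (p, i)<..c (p, Suc i)}})) ps is)"
    using assms unfolding offer_def by (rule map_of_SomeD)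
  then show ?thesis using that by auto
qed

lemma offer_nth:
  assumes "distinct ps" "length is = length ps" "j < length ps"
  shows "offer c ps is (ps ! j) = Some {{c (ps ! j, is ! j)<..c (ps ! j, Suc (is ! j))}}"
proof -
  have "map fst (map2 (\<lambda>p i. (p, {{c (p, i)<..c (p, Suc i)}})) ps is) = ps"
    using assms(2) by (simp add: case_prod_unfold o_def)
  then show ?thesis
    unfolding offer_def using assms
    by (intro map_of_is_SomeI) (auto simp: set_zip intro!: rev_image_eqI)
qed

text \<open>\<open>Q\<close> has to be a submap of the offer of a single trial; pieces from
  different trials are never mixed.\<close>

definition acceptable ::
    "nat \<Rightarrow> (player \<times> nat \<Rightarrow> real) \<Rightarrow> player list \<Rightarrow> nat list list \<Rightarrow> allocation \<Rightarrow> bool" where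
  "acceptable r c ps iss Q \<longleftrightarrow>
     (\<exists>is\<in>set iss. Q \<subseteq>\<^sub>m offer c ps is) \<and> card (dom Q) = r \<and> disjoint_portions Q"

text \<open>A packing of at least \<open>r\<close> indices is thinned out to exactly
  \<open>r\<close>, and the offer is restricted to the corresponding players.\<close>

lemma acceptable_exists:
  assumes "distinct ps" "length is = length ps" "is \<in> set iss"
    and "r \<le> packing_number (length ps) (\<lambda>j. {c (ps ! j, is ! j)<..c (ps ! j, Suc (is ! j))})"
  shows "\<exists>Q. acceptable r c ps iss Q"
proof -
  let ?I = "\<lambda>j. {c (ps ! j, is ! j)<..c (ps ! j, Suc (is ! j))}"
  obtain T where T: "T \<subseteq> {..<length ps}" "disjoint_family_on ?I T" "r \<le> card T"
    using packing_number_witness[of "length ps" ?I] assms(4) by metis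
  obtain T' where T': "T' \<subseteq> T" "card T' = r"
    using T(3) by (meson obtain_subset_with_card_n)
  define Q where "Q = offer c ps is |` ((!) ps ` T')"
  have Q: "\<exists>j\<in>T'. p = ps ! j \<and> C = {?I j}" if "Q p = Some C" for p C
  proof -
    have "p \<in> (!) ps ` T'" "offer c ps is p = Some C"
      using that by (auto simp: Q_def restrict_map_def split: if_splits)
    moreover from this obtain j where "j \<in> T'" "p = ps ! j" by blast
    moreover from this have "j < length ps" using T(1) T'(1) by auto
    ultimately show ?thesis using offer_nth[OF assms(1,2), of j c] by auto
  qed
  have "(!) ps ` T' \<subseteq> dom (offer c ps is)"
    using offer_nth[OF assms(1,2), of _ c] T(1) T'(1) by blast
  then have "dom Q = (!) ps ` T'" by (simp add: Q_def Int_absorb1)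
  moreover have "inj_on ((!) ps) T'"
    using assms(1) T(1) T'(1) by (intro inj_on_nth) auto
  ultimately have "card (dom Q) = r" using T'(2) by (simp add: card_image)
  moreover have "disjoint_portions Q"
    unfolding disjoint_portions_def
  proof (intro allI impI, elim conjE)
    fix p q C D assume "Q p = Some C" "Q q = Some D" "p \<noteq> q"
    then obtain j k where "j \<in> T'" "k \<in> T'" "j \<noteq> k" "C = {?I j}" "D = {?I k}"
      using Q by blast
    then show "\<Union>C \<inter> \<Union>D = {}"
      using T(2) T'(1) unfolding disjoint_family_on_def by auto
  qed
  moreover have "Q \<subseteq>\<^sub>m offer c ps is" by (auto simp: Q_def map_le_def restrict_map_def)
  ultimately show ?thesis using assms(3) unfolding acceptable_def by blast
qed

text \<open>The sample \<open>xs\<close> and the picks \<open>iss\<close> of all trials are drawn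
  beforehand, so everything here is deterministic. \<open>SOME\<close> hides no information about
  the valuation, because acceptability depends on it only through query answers. Failure is reported
  by empty allocations and a completion part without queries.\<close>

definition preassign ::
    "nat \<Rightarrow> nat \<Rightarrow> real \<Rightarrow> player list \<Rightarrow> nat list list \<Rightarrow> two_part_algorithm" where
  "preassign n r \<epsilon> xs iss = ask xs (\<lambda>p. Cut 0 1 p \<epsilon>) (\<lambda>y.
     let ps = take (8 * r) (sort_key y (remdups xs)) in
     if length ps < 8 * r then Return (Map.empty, Return Map.empty)
     else ask (concat (map (\<lambda>is. concat (map2 (\<lambda>p i. [(p, i), (p, Suc i)]) ps is)) iss))
       (\<lambda>(p, m). Cut 0 1 p (real m / real n)) (\<lambda>c.
         if \<exists>Q. acceptable r c ps iss Q
         then let Q = SOME Q. acceptable r c ps iss Q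
           in Return (Q, completion n \<epsilon> (y (last ps)) (dom Q))
         else Return (Map.empty, Return Map.empty)))"

text \<open>The list \<open>ps\<close> of \<open>preassign\<close> as a function of the valuation.
  The default 0 repeats that of \<open>ask\<close>, so that the sort keys coincide.\<close>

definition chosen :: "nat \<Rightarrow> nat \<Rightarrow> real \<Rightarrow> valuation \<Rightarrow> player list \<Rightarrow> player list" where
  "chosen n r \<epsilon> V xs =
     take (8 * r) (sort_key (\<lambda>p. if p \<in> set xs then mark n V p \<epsilon> else 0) (remdups xs))"

lemma chosen:
  "distinct (chosen n r \<epsilon> V xs)" "set (chosen n r \<epsilon> V xs) \<subseteq> set xs"
  "length (chosen n r \<epsilon> V xs) = min (8 * r) (card (set xs))"
  unfolding chosen_def
  using set_take_subset[of "8 * r" "sort_key (\<lambda>p. if p \<in> set xs then mark n V p \<epsilon> else 0) (remdups xs)"]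
  by (auto simp: length_remdups_card_conv)

lemma sum_list_map_le:
  fixes f :: "'a \<Rightarrow> nat"
  assumes "\<And>x. x \<in> set xs \<Longrightarrow> f x \<le> b"
  shows "sum_list (map f xs) \<le> length xs * b"
  using assms by (induction xs) (auto intro: add_mono)

text \<open>The deterministic core. For fixed draws the execution is a point mass within the query
  bounds, and success is reduced to two events: enough sampled players at or below the quantile
  \<open>v\<close>, and one trial with \<open>r\<close> disjoint picks.\<close>

lemma run_preassign:
  assumes V: "\<forall>p<n. value_function (V p)"
    and \<epsilon>: "0 < \<epsilon>" "\<epsilon> \<le> 1" and r: "0 < r" "127 * real r \<le> \<epsilon> * real n"
    and xs: "set xs \<subseteq> {..<n}"
    and iss: "\<And>is. is \<in> set iss \<Longrightarrow> length is = 8 * r \<and> set is \<subseteq> {..<127 * r}"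
    and v: "real (card {p. p < n \<and> mark n V p \<epsilon> < v}) \<le> \<epsilon> * real n"
  obtains Q c1 R c2 where "execute n V (preassign n r \<epsilon> xs iss) = return_pmf ((Q, c1), (R, c2))"
    "c1 \<le> length xs + length iss * (16 * r)" "c2 \<le> n + nat \<lceil>log 2 (real n)\<rceil> * n"
    "8 * r \<le> card ({p. p < n \<and> mark n V p \<epsilon> \<le> v} \<inter> set xs) \<Longrightarrow>
      \<exists>is\<in>set iss. r \<le> packing_number (8 * r) (\<lambda>j.
        {mark n V (chosen n r \<epsilon> V xs ! j) (real (is ! j) / real n)
        <..mark n V (chosen n r \<epsilon> V xs ! j) (real (Suc (is ! j)) / real n)}) \<Longrightarrow>
      success n r \<epsilon> V Q R"
proof -
  define y where "y = (\<lambda>p. if p \<in> set xs then mark n V p \<epsilon> else 0)"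
  define ps where "ps = chosen n r \<epsilon> V xs"
  have ps: "distinct ps" "set ps \<subseteq> set xs" "ps = take (8 * r) (sort_key y (remdups xs))"
    using chosen[of n r \<epsilon> V xs] by (auto simp: ps_def chosen_def y_def)
  let ?none = "Return (Map.empty, Return Map.empty) :: two_part_algorithm"
  let ?qs = "concat (map (\<lambda>is. concat (map2 (\<lambda>p i. [(p, i), (p, Suc i)]) ps is)) iss)"
  define c where "c = (\<lambda>i. if i \<in> set ?qs
    then the (answer n V ((\<lambda>(p, m). Cut 0 1 p (real m / real n)) i)) else 0)"
  let ?acc = "acceptable r c ps iss"
  define K where "K = (if \<exists>Q. ?acc Q
    then let Q = SOME Q. ?acc Q in Return (Q, completion n \<epsilon> (y (last ps)) (dom Q)) else ?none)"
  have n: "0 < n" using r \<epsilon> by (intro Nat.gr0I) auto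
  have run1: "run n V (preassign n r \<epsilon> xs iss) = map_pmf (apsnd ((+) (length xs)))
      (run n V (if length ps < 8 * r then ?none else
        ask ?qs (\<lambda>(p, m). Cut 0 1 p (real m / real n)) (\<lambda>c.
         if \<exists>Q. acceptable r c ps iss Q
         then let Q = SOME Q. acceptable r c ps iss Q
           in Return (Q, completion n \<epsilon> (y (last ps)) (dom Q))
         else ?none)))"
    unfolding preassign_def run_ask ps(3) y_def mark_def Let_def by (rule refl)
  have run2: "run n V (preassign n r \<epsilon> xs iss)
      = map_pmf (apsnd ((+) (length xs + length ?qs))) (run n V K)" if "\<not> length ps < 8 * r"
    unfolding run1 if_not_P[OF that] run_ask c_def[symmetric] K_def[symmetric]
    by (simp add: pmf.map_comp o_def apsnd_def map_prod_def case_prod_unfold add.assoc)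
  have len_qs: "length ?qs \<le> length iss * (16 * r)"
  proof -
    have "length (concat (map2 (\<lambda>p i. [(p, i), (p, Suc i)]) ps is)) \<le> 16 * r" if "is \<in> set iss" for "is"
    proof -
      have "length (concat (map2 (\<lambda>p i. [(p, i), (p, Suc i)]) ps is))
          = sum_list (map (\<lambda>_. Suc (Suc 0)) (zip ps is))"
        by (simp add: length_concat case_prod_unfold o_def)
      also have "\<dots> \<le> length is * 2" by (simp add: sum_list_triv)
      finally show ?thesis using iss[OF that] by simp
    qed
    then show ?thesis
      unfolding length_concat map_map o_def by (rule sum_list_map_le)
  qed
  let ?good = "8 * r \<le> card ({p. p < n \<and> mark n V p \<epsilon> \<le> v} \<inter> set xs)"
  let ?I = "\<lambda>is j. {mark n V (ps ! j) (real (is ! j) / real n)<..mark n V (ps ! j) (real (Suc (is ! j)) / real n)}"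
  note result = that
  \<comment> \<open>For branches that allocate nothing: \<open>imp\<close> refutes the two
    conditions, so the implication to success holds vacuously.\<close>
  have fail: thesis if "execute n V (preassign n r \<epsilon> xs iss) = return_pmf ((Map.empty, e), (Map.empty, 0))"
      "e \<le> length xs + length iss * (16 * r)"
      and imp: "?good \<Longrightarrow> \<exists>is\<in>set iss. r \<le> packing_number (8 * r) (?I is) \<Longrightarrow> False" for e
  proof (rule result[OF that(1,2)])
    show "0 \<le> n + nat \<lceil>log 2 (real n)\<rceil> * n" by simp
    show "success n r \<epsilon> V Map.empty Map.empty"
      if "?good" "\<exists>is\<in>set iss. r \<le> packing_number (8 * r) (\<lambda>j.
        {mark n V (chosen n r \<epsilon> V xs ! j) (real (is ! j) / real n)
        <..mark n V (chosen n r \<epsilon> V xs ! j) (real (Suc (is ! j)) / real n)})"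
      using imp that unfolding ps_def by blast
  qed
  show thesis
  proof (cases "length ps < 8 * r")
    case True
    have "execute n V (preassign n r \<epsilon> xs iss) = return_pmf ((Map.empty, length xs), (Map.empty, 0))"
      using True by (simp add: execute_def run1 bind_return_pmf)
    moreover have False if ?good
    proof -
      have "card ({p. p < n \<and> mark n V p \<epsilon> \<le> v} \<inter> set xs) \<le> card (set xs)"
        by (intro card_mono) auto
      then show False using that True chosen(3)[of n r \<epsilon> V xs] by (simp add: ps_def)
    qed
    ultimately show thesis by (intro fail) auto
  next
    case len: False
    then have len_ps: "length ps = 8 * r" using chosen(3)[of n r \<epsilon> V xs] by (simp add: ps_def)
    have c: "c (p, i) = mark n V p (real i / real n)" "c (p, Suc i) = mark n V p (real (Suc i) / real n)"
      if "is \<in> set iss" "(p, i) \<in> set (zip ps is)" for p i "is"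
    proof -
      have "(p, i) \<in> set ?qs" "(p, Suc i) \<in> set ?qs" using that by force+
      then show "c (p, i) = mark n V p (real i / real n)" "c (p, Suc i) = mark n V p (real (Suc i) / real n)"
        unfolding c_def mark_def by (simp_all only: if_True prod.case)
    qed
    show thesis
    proof (cases "\<exists>Q. ?acc Q")
      case False
      have "execute n V (preassign n r \<epsilon> xs iss)
          = return_pmf ((Map.empty, length xs + length ?qs), (Map.empty, 0))"
        using False by (simp add: execute_def run2[OF len] K_def bind_return_pmf)
      moreover have False if "is \<in> set iss" "r \<le> packing_number (8 * r) (?I is)" for "is"
      proof -
        have "c (ps ! j, is ! j) = mark n V (ps ! j) (real (is ! j) / real n)
            \<and> c (ps ! j, Suc (is ! j)) = mark n V (ps ! j) (real (Suc (is ! j)) / real n)"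
          if "j < length ps" for j
          using c[OF \<open>is \<in> set iss\<close>, of "ps ! j" "is ! j"] that iss[OF \<open>is \<in> set iss\<close>] len_ps
          by (auto simp: set_zip)
        then have "packing_number (8 * r) (?I is)
            = packing_number (length ps) (\<lambda>j. {c (ps ! j, is ! j)<..c (ps ! j, Suc (is ! j))})"
          unfolding len_ps by (intro packing_number_cong) simp
        then show False
          using acceptable_exists[OF ps(1) _ that(1), of r c] iss[OF that(1)] len_ps that(2) False by auto
      qed
      ultimately show thesis using len_qs by (intro fail) auto
    next
      case True
      define Q where "Q = (SOME Q. ?acc Q)"
      have "?acc Q" unfolding Q_def using True by (rule someI_ex)
      then obtain "is" where Q: "is \<in> set iss" "Q \<subseteq>\<^sub>m offer c ps is" "card (dom Q) = r" "disjoint_portions Q"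
        by (auto simp: acceptable_def)
      define x where "x = y (last ps)"
      have ps_ne: "ps \<noteq> []" using len_ps r by auto
      have h: "0 < 8 * r" "8 * r \<le> length (remdups xs)"
        using r len_ps ps(3) by auto
      have x_nth: "x = y (sort_key y (remdups xs) ! (8 * r - 1))"
        unfolding x_def last_conv_nth[OF ps_ne] len_ps using r by (simp add: ps(3))
      have yp: "y p = mark n V p \<epsilon>" if "p \<in> set xs" for p using that by (simp add: y_def)
      have le_x: "mark n V p \<epsilon> \<le> x" if "p \<in> set ps" for p
        using sort_key_split(1)[OF h, of p y] that ps yp[of p] by (auto simp: x_nth)
      have "last ps \<in> set xs" using ps(2) ps_ne last_in_set by blast
      then have x01: "0 \<le> x" "x \<le> 1"
        using mark(1,2)[where V = V and n = n and p = "last ps" and \<alpha> = \<epsilon>] V xs \<epsilon> yp[of "last ps"] by (auto simp: x_def)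
      \<comment> \<open>Consecutive marks bound a piece of value \<open>1 / n\<close>. Since
        \<open>i < 127 * r\<close>, its right end is a mark at value at most \<epsilon>, hence at
        most \<open>x\<close>.\<close>
      have piece: "p \<in> set ps \<and> is_portion C \<and> \<Union>C \<subseteq> {0<..x} \<and> fair n (V p) C" if "Q p = Some C" for p C
      proof -
        have "offer c ps is p = Some C" using Q(2) that by (metis domI map_le_def)
        then obtain i where i: "(p, i) \<in> set (zip ps is)" "C = {{c (p, i)<..c (p, Suc i)}}"
          by (rule offer_SomeD)
        have p: "p \<in> set ps" "p < n" and i': "i < 127 * r"
          using set_zip_leftD[OF i(1)] set_zip_rightD[OF i(1)] iss[OF Q(1)] ps(2) xs by auto
        have Vp: "value_function (V p)" using V p by simp
        define \<alpha> \<beta> where "\<alpha> = real i / real n" and "\<beta> = real (Suc i) / real n"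
        have "real (Suc i) \<le> 127 * real r" using i' by linarith
        then have ab: "0 \<le> \<alpha>" "\<alpha> \<le> \<beta>" "\<beta> \<le> \<epsilon>"
          using r n by (auto simp: \<alpha>_def \<beta>_def divide_right_mono pos_divide_le_eq)
        have C: "C = {{mark n V p \<alpha><..mark n V p \<beta>}}"
          using i c[OF Q(1) i(1)] by (simp add: \<alpha>_def \<beta>_def)
        have "mark n V p \<beta> \<le> mark n V p \<epsilon>"
          using ab \<epsilon> p Vp by (intro mark_mono) auto
        then have "mark n V p \<beta> \<le> x" using le_x[OF p(1)] by (rule order_trans)
        then have m: "0 \<le> mark n V p \<alpha>" "mark n V p \<alpha> \<le> mark n V p \<beta>" "mark n V p \<beta> \<le> x" "mark n V p \<beta> \<le> 1"
          using mark[where V = V and p = p, OF Vp p(2)] mark_mono[where V = V and p = p, OF Vp p(2)] ab \<epsilon>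
          by auto
        have "V p {0..mark n V p \<beta>} = V p {0..mark n V p \<alpha>} + V p {mark n V p \<alpha><..mark n V p \<beta>}"
          using m by (intro value_function_split[OF Vp]) auto
        then have "V p {mark n V p \<alpha><..mark n V p \<beta>} = \<beta> - \<alpha>"
          using mark(3)[where V = V and p = p, OF Vp p(2)] ab \<epsilon> by simp
        also have "\<beta> - \<alpha> = 1 / real n" by (simp add: \<alpha>_def \<beta>_def diff_divide_distrib[symmetric])
        finally have "fair n (V p) C" by (simp add: fair_def C)
        moreover have "is_portion C" unfolding C using m by (intro is_portion_half_open) auto
        moreover have "\<Union>C \<subseteq> {0<..x}" using m by (auto simp: C)
        ultimately show ?thesis using p by blast
      qed
      have servesQ: "serves n V (dom Q) 0 x Q"
        using piece Q(4) by (auto simp: serves_def)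
      have "dom Q \<subseteq> set ps"
      proof
        fix p assume "p \<in> dom Q"
        then obtain C where "Q p = Some C" by (auto simp: dom_def)
        then show "p \<in> set ps" using piece[of p C] by (simp only:)
      qed
      then have domQ1: "dom Q \<subseteq> {..<n}"
        using ps(2) xs by (meson subset_trans)
      have "dom Q \<noteq> {}"
      proof
        assume "dom Q = {}"
        then have "card (dom Q) = 0" by (simp only: card.empty)
        then show False using Q(3) r(1) by (simp only: less_irrefl)
      qed
      note domQ = domQ1 this
      obtain R c2 where R: "run n V (completion n \<epsilon> x (dom Q)) = return_pmf (R, c2)"
        "c2 \<le> n + nat \<lceil>log 2 (real n)\<rceil> * n" "serves n V (dom R) x 1 R" "dom R \<subseteq> {..<n} - dom Q"
        "real (card {p. p < n \<and> \<epsilon> < V p {0..x}}) \<le> \<epsilon> * real n \<longrightarrow>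
         real (card ({..<n} - dom Q - dom R)) \<le> \<epsilon> * real n"
        by (rule run_completion[OF V n less_imp_le[OF \<epsilon>(1)] \<epsilon>(2) x01 domQ]) (rule that)
      have "run n V K = return_pmf ((Q, completion n \<epsilon> x (dom Q)), 0)"
        using True by (simp add: K_def Let_def Q_def x_def)
      then have "execute n V (preassign n r \<epsilon> xs iss)
          = return_pmf ((Q, length xs + length ?qs), (R, c2))"
        by (simp add: execute_def run2[OF len] R(1) bind_return_pmf)
      moreover have "success n r \<epsilon> V Q R" if ?good
      proof -
        \<comment> \<open>Otherwise \<open>8 * r\<close> sampled players would have marks strictly
          below the \<open>8 * r\<close>-th smallest mark \<open>x\<close>.\<close>
        have "x \<le> v"
        proof (rule ccontr)
          assume "\<not> x \<le> v"
          then have "{p. p < n \<and> mark n V p \<epsilon> \<le> v} \<inter> set xs \<subseteq> {p \<in> set (remdups xs). y p < x}"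
            by (auto simp: yp)
          then have "card ({p. p < n \<and> mark n V p \<epsilon> \<le> v} \<inter> set xs) \<le> card {p \<in> set (remdups xs). y p < x}"
            by (intro card_mono) auto
          also have "\<dots> < 8 * r" unfolding x_nth by (rule card_less_sort_key_nth[OF h])
          finally show False using that by simp
        qed
        \<comment> \<open>A player whose mark is at least \<open>v\<close>, hence at least
          \<open>x\<close>, values \<open>{0..x}\<close> at no more than \<epsilon>.\<close>
        have "mark n V p \<epsilon> < v" if p: "p < n" "\<epsilon> < V p {0..x}" for p
        proof (rule ccontr)
          assume "\<not> ?thesis"
          then have "x \<le> mark n V p \<epsilon>" using \<open>x \<le> v\<close> by simp
          moreover have Vp: "value_function (V p)" using V p by simp
          moreover have "mark n V p \<epsilon> \<le> 1" "V p {0..mark n V p \<epsilon>} = \<epsilon>" using mark[where V = V and p = p, OF Vp p(1)] \<epsilon> by auto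
          ultimately show False using value_function_mono[OF Vp, of 0 x "mark n V p \<epsilon>"] p by simp
        qed
        then have "card {p. p < n \<and> \<epsilon> < V p {0..x}} \<le> card {p. p < n \<and> mark n V p \<epsilon> < v}"
          by (intro card_mono) auto
        then have few: "real (card ({..<n} - dom Q - dom R)) \<le> \<epsilon> * real n"
          using v by (intro R(5)[rule_format]) linarith
        have "victims n V Q R \<subseteq> {..<n} - dom Q - dom R"
          using R(3) by (auto simp: victims_def serves_def)
        then have "card (victims n V Q R) \<le> card ({..<n} - dom Q - dom R)" by (intro card_mono) auto
        then have "real (card (victims n V Q R)) \<le> \<epsilon> * real n" using few by linarith
        moreover have "disjoint_portions (Q ++ R)"
          using serves_merge[OF servesQ R(3) x01] by (simp add: serves_def)
        moreover have "\<forall>C \<in> ran Q \<union> ran R. is_portion C"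
          using servesQ R(3) by (auto simp: serves_def ran_def)
        moreover have "\<forall>p C. Q p = Some C \<longrightarrow> fair n (V p) C" using piece by blast
        ultimately show ?thesis using domQ Q(3) R(4) by (simp add: success_def)
      qed
      ultimately show thesis using len_qs R(2) by (intro result[of Q "length xs + length ?qs" R c2]) auto
    qed
  qed
qed

subsection \<open>Probability of failure\<close>

lemma prob_pair_pmf_le:
  assumes "\<And>x. x \<in> set_pmf p \<Longrightarrow> measure_pmf.prob q {y. P x y} \<le> c" "0 \<le> c"
  shows "measure_pmf.prob (pair_pmf p q) {(x, y). P x y} \<le> c"
proof -
  have "emeasure (measure_pmf (pair_pmf p q)) {(x, y). P x y}
      = (\<integral>\<^sup>+x. emeasure (measure_pmf (map_pmf (Pair x) q)) {(x, y). P x y} \<partial>measure_pmf p)"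
    by (simp add: pair_pmf_def map_pmf_def del: emeasure_map_pmf)
  also have "\<dots> \<le> (\<integral>\<^sup>+x. ennreal c \<partial>measure_pmf p)"
    using assms by (intro nn_integral_mono_AE)
      (auto simp: AE_measure_pmf_iff vimage_def measure_pmf.emeasure_eq_measure intro: ennreal_leI)
  also have "\<dots> = ennreal c" by simp
  finally show ?thesis using assms(2) by (simp add: measure_pmf.emeasure_eq_measure)
qed

section \<open>Numerical estimates\<close>

lemma trials_bound:
  assumes "0 < r" "0 < (t::real)"
  shows "(1 / (4 * real r)) ^ nat \<lceil>t\<rceil> \<le> 1 / (t\<^sup>2 * real r)"
proof -
  define J where "J = nat \<lceil>t\<rceil>"
  have J: "t \<le> real J" "1 \<le> J" using assms(2) by (auto simp: J_def) linarith+
  \<comment> \<open>From \<open>t \<le> J \<le> 2 ^ J\<close>, the factor \<open>4 ^ J\<close>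
    dominates the square of \<open>t\<close>; of \<open>r ^ J\<close> only one factor is
    kept.\<close>
  have "real J \<le> 2 ^ J" by (metis less_exp of_nat_less_iff of_nat_numeral of_nat_power less_imp_le)
  then have "t\<^sup>2 \<le> (2 ^ J)\<^sup>2" using J assms by (intro power_mono) linarith+
  also have "(2 ^ J)\<^sup>2 = (4::real) ^ J" by (simp add: power2_eq_square flip: power_mult_distrib)
  finally have 4: "t\<^sup>2 \<le> 4 ^ J" .
  have "real r ^ 1 \<le> real r ^ J" using assms J by (intro power_increasing) auto
  then have "t\<^sup>2 * real r \<le> 4 ^ J * real r ^ J" using 4 by (intro mult_mono) auto
  then have "1 / (4 ^ J * real r ^ J) \<le> 1 / (t\<^sup>2 * real r)"
    using assms by (intro divide_left_mono) auto
  then show ?thesis by (simp add: J_def power_divide power_mult_distrib)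
qed

text \<open>With \<open>2 \<le> exp 1\<close> and
  \<open>1 - \<epsilon> / 4 \<le> exp (- \<epsilon> / 4)\<close> the exponent is at most
  \<open>8 * r - 16 * t * r\<close>, hence at most \<open>- 2 * t * r\<close>. Then
  \<open>t * r \<le> exp (t * r)\<close> makes the bound polynomial.\<close>

lemma sampling_bound:
  assumes "0 < r" "3 / 2 < (t::real)" "0 < (\<epsilon>::real)" "\<epsilon> \<le> 1"
  shows "2 ^ (8 * r) * (1 - \<epsilon> / 2 / 2) ^ nat \<lceil>64 * t * real r / \<epsilon>\<rceil> \<le> 1 / (t\<^sup>2 * real r)"
proof -
  define N where "N = nat \<lceil>64 * t * real r / \<epsilon>\<rceil>"
  have "64 * t * real r / \<epsilon> \<le> real N" unfolding N_def by linarith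
  then have N: "16 * t * real r \<le> \<epsilon> / 4 * real N" using assms(3) by (simp add: field_simps)
  have "(2::real) ^ (8 * r) \<le> exp 1 ^ (8 * r)"
    using exp_ge_add_one_self[of "1::real"] by (intro power_mono) auto
  moreover have "(1 - \<epsilon> / 2 / 2) ^ N \<le> exp (- (\<epsilon> / 4)) ^ N"
    using exp_ge_add_one_self[of "- (\<epsilon> / 4)"] assms by (intro power_mono) auto
  ultimately have "2 ^ (8 * r) * (1 - \<epsilon> / 2 / 2) ^ N \<le> exp 1 ^ (8 * r) * exp (- (\<epsilon> / 4)) ^ N"
    using assms by (intro mult_mono) auto
  also have "\<dots> = exp (8 * real r - \<epsilon> / 4 * real N)"
    by (simp add: mult.commute flip: exp_of_nat_mult exp_add)
  also have "\<dots> \<le> exp (- (2 * (t * real r)))"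
  proof -
    have "1 * real r \<le> t * real r" using assms by (intro mult_right_mono) auto
    then show ?thesis using N by simp
  qed
  also have "\<dots> = 1 / (exp (t * real r))\<^sup>2"
    by (simp add: exp_minus inverse_eq_divide exp_double)
  also have "\<dots> \<le> 1 / (t\<^sup>2 * real r)"
  proof (intro divide_left_mono)
    have "t * real r \<le> exp (t * real r)" using exp_ge_add_one_self[of "t * real r"] by linarith
    then have "(t * real r)\<^sup>2 \<le> (exp (t * real r))\<^sup>2" using assms by (intro power_mono) auto
    moreover have "t\<^sup>2 * real r \<le> (t * real r)\<^sup>2"
      using assms by (simp add: power_mult_distrib power2_eq_square)
    ultimately show "t\<^sup>2 * real r \<le> (exp (t * real r))\<^sup>2" by linarith
  qed (use assms in auto)
  finally show ?thesis by (simp add: N_def)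
qed

text \<open>Since \<open>log 2 n \<le> 3 / 2 * ln n\<close> and \<open>1 \<le> ln n\<close>, the
  initial evaluations and the rounding are absorbed.\<close>

lemma completion_count_bound:
  assumes "127 \<le> n"
  shows "real (n + nat \<lceil>log 2 (real n)\<rceil> * n) \<le> 4 * (real n * ln (real n))"
proof -
  have n: "0 < real n" "0 \<le> log 2 (real n)" using assms by auto
  have "exp 1 \<le> real n" using exp_le assms by linarith
  then have 1: "1 \<le> ln (real n)" using n by (simp add: ln_ge_iff)
  have "(2 / 3 :: real) \<le> ln 2" using ln2_ge_two_thirds by simp
  then have "ln (real n) / ln 2 \<le> ln (real n) / (2 / 3)" using 1 by (intro divide_left_mono) auto
  then have "log 2 (real n) \<le> 3 / 2 * ln (real n)" by (simp add: log_def)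
  then have "1 + real (nat \<lceil>log 2 (real n)\<rceil>) \<le> 4 * ln (real n)" using n 1 by linarith
  then have "real n * (1 + real (nat \<lceil>log 2 (real n)\<rceil>)) \<le> real n * (4 * ln (real n))"
    by (intro mult_left_mono) auto
  then show ?thesis by (simp add: algebra_simps)
qed

text \<open>The constant is \<open>64 + 1 + 32\<close>: the sample, its rounding, and
  \<open>16 * r\<close> cuts for each of at most \<open>2 * t\<close> trials.\<close>

lemma preassign_count_bound:
  assumes "0 < r" "3 / 2 < (t::real)" "0 < (\<epsilon>::real)" "\<epsilon> \<le> 1"
  shows "real (nat \<lceil>64 * t * real r / \<epsilon>\<rceil> + nat \<lceil>t\<rceil> * (16 * r)) \<le> 97 * (t * real r / \<epsilon>)"
proof -
  have "1 * 1 \<le> t * real r" using assms by (intro mult_mono) auto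
  moreover have tr: "t * real r * 1 \<le> t * real r * (1 / \<epsilon>)"
    using assms by (intro mult_left_mono) auto
  ultimately have "1 \<le> t * real r / \<epsilon>" by simp
  moreover have "real (nat \<lceil>64 * t * real r / \<epsilon>\<rceil>) \<le> 64 * (t * real r / \<epsilon>) + 1"
    using assms by (simp add: mult.assoc)
  moreover have "real (nat \<lceil>t\<rceil>) * (16 * real r) \<le> 32 * (t * real r / \<epsilon>)"
  proof -
    have "real (nat \<lceil>t\<rceil>) \<le> 2 * t" using assms by linarith
    then have "real (nat \<lceil>t\<rceil>) * (16 * real r) \<le> 2 * t * (16 * real r)" by (intro mult_right_mono) auto
    also have "\<dots> = 32 * (t * real r)" by simp
    also have "\<dots> \<le> 32 * (t * real r / \<epsilon>)" using tr by simp
    finally show ?thesis .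
  qed
  ultimately show ?thesis by simp
qed

section \<open>The randomized algorithm and its guarantees\<close>

definition draws :: "nat \<Rightarrow> nat \<Rightarrow> real \<Rightarrow> real \<Rightarrow> (player list \<times> nat list list) pmf" where
  "draws n r \<epsilon> t = pair_pmf
     (replicate_pmf (nat \<lceil>64 * t * real r / \<epsilon>\<rceil>) (pmf_of_set {..<n}))
     (replicate_pmf (nat \<lceil>t\<rceil>) (replicate_pmf (8 * r) (pmf_of_set {..<127 * r})))"

text \<open>A \<open>Random\<close> node draws a natural number, so the pair of lists passes through
  the countable encoding \<open>to_nat\<close>.\<close>

definition algorithm :: "nat \<Rightarrow> nat \<Rightarrow> real \<Rightarrow> real \<Rightarrow> two_part_algorithm" where
  "algorithm n r \<epsilon> t = Random (map_pmf to_nat (draws n r \<epsilon> t))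
     (\<lambda>i. case from_nat i of (xs, iss) \<Rightarrow> preassign n r \<epsilon> xs iss)"

lemma execute_algorithm:
  "execute n V (algorithm n r \<epsilon> t) = draws n r \<epsilon> t \<bind> (\<lambda>(xs, iss). execute n V (preassign n r \<epsilon> xs iss))"
  by (simp add: algorithm_def execute_def bind_map_pmf bind_assoc_pmf case_prod_unfold)

lemma algorithm_correct:
  assumes V: "\<forall>p<n. value_function (V p)"
    and \<epsilon>: "0 < \<epsilon>" "\<epsilon> \<le> 1" and r: "0 < r" "127 * real r \<le> \<epsilon> * real n" and t: "3 / 2 < t"
  shows "((Q, c1), (R, c2)) \<in> set_pmf (execute n V (algorithm n r \<epsilon> t)) \<Longrightarrow>
      real c1 \<le> 97 * (t * real r / \<epsilon>) \<and> real c2 \<le> 4 * (real n * ln (real n))"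
    and "1 - 2 / (t\<^sup>2 * real r)
      \<le> measure_pmf.prob (execute n V (algorithm n r \<epsilon> t)) {((Q, c1), (R, c2)). success n r \<epsilon> V Q R}"
proof -
  let ?N = "nat \<lceil>64 * t * real r / \<epsilon>\<rceil>" and ?J = "nat \<lceil>t\<rceil>" and ?D = "draws n r \<epsilon> t"
  let ?trial = "replicate_pmf (8 * r) (pmf_of_set {..<127 * r})"
  have n: "127 \<le> n"
  proof -
    have "\<epsilon> * real n \<le> 1 * real n" using \<epsilon> by (intro mult_right_mono) auto
    then have "real (127 * r) \<le> real n" using r by simp
    then have "127 * r \<le> n" by (simp only: of_nat_le_iff)
    then show ?thesis using r by simp
  qed
  have "0 < \<epsilon> * real n" "\<epsilon> * real n \<le> real n" using \<epsilon> n by auto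
  then obtain v where v: "\<epsilon> * real n \<le> real (card {p. p < n \<and> mark n V p \<epsilon> \<le> v})"
    "real (card {p. p < n \<and> mark n V p \<epsilon> < v}) \<le> \<epsilon> * real n"
    by (rule quantile_exists)
  define L where "L = {p. p < n \<and> mark n V p \<epsilon> \<le> v}"
  let ?pack = "\<lambda>xs is. packing_number (8 * r) (\<lambda>j. {mark n V (chosen n r \<epsilon> V xs ! j) (real (is ! j) / real n)
        <..mark n V (chosen n r \<epsilon> V xs ! j) (real (Suc (is ! j)) / real n)})"
  have supp_n: "set_pmf (pmf_of_set {..<n}) = {..<n}"
    using n by (intro set_pmf_of_set) (auto simp: lessThan_empty_iff)
  have supp_M: "set_pmf (pmf_of_set {..<127 * r}) = {..<127 * r}"
    using r by (intro set_pmf_of_set) (auto simp: lessThan_empty_iff)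
  have "\<exists>Q c1 R c2. execute n V (preassign n r \<epsilon> xs iss) = return_pmf ((Q, c1), (R, c2)) \<and>
      c1 \<le> ?N + ?J * (16 * r) \<and> c2 \<le> n + nat \<lceil>log 2 (real n)\<rceil> * n \<and>
      (8 * r \<le> card (L \<inter> set xs) \<and> (\<exists>is\<in>set iss. r \<le> ?pack xs is) \<longrightarrow> success n r \<epsilon> V Q R)"
    if "(xs, iss) \<in> set_pmf ?D" for xs iss
  proof -
    have xs: "set xs \<subseteq> {..<n}" "length xs = ?N" and
      iss: "\<And>is. is \<in> set iss \<Longrightarrow> length is = 8 * r \<and> set is \<subseteq> {..<127 * r}" "length iss = ?J"
      using that by (auto simp: draws_def set_replicate_pmf supp_n supp_M)
    show ?thesis
      by (rule run_preassign[OF V \<epsilon> r xs(1) iss(1) v(2)]) (use xs iss in \<open>auto simp: L_def\<close>)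
  qed
  \<comment> \<open>A choice function \<open>out\<close> for these point masses exhibits the
    execution as an image of the draws, which reduces the claim to events about the draws.\<close>
  then have "\<forall>\<omega>\<in>set_pmf ?D. \<exists>z. execute n V (preassign n r \<epsilon> (fst \<omega>) (snd \<omega>)) = return_pmf z \<and>
      snd (fst z) \<le> ?N + ?J * (16 * r) \<and> snd (snd z) \<le> n + nat \<lceil>log 2 (real n)\<rceil> * n \<and>
      (8 * r \<le> card (L \<inter> set (fst \<omega>)) \<and> (\<exists>is\<in>set (snd \<omega>). r \<le> ?pack (fst \<omega>) is)
        \<longrightarrow> success n r \<epsilon> V (fst (fst z)) (fst (snd z)))"
    by fastforce
  from bchoice[OF this] obtain out where "\<forall>\<omega>\<in>set_pmf ?D.
      execute n V (preassign n r \<epsilon> (fst \<omega>) (snd \<omega>)) = return_pmf (out \<omega>) \<and>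
      snd (fst (out \<omega>)) \<le> ?N + ?J * (16 * r) \<and> snd (snd (out \<omega>)) \<le> n + nat \<lceil>log 2 (real n)\<rceil> * n \<and>
      (8 * r \<le> card (L \<inter> set (fst \<omega>)) \<and> (\<exists>is\<in>set (snd \<omega>). r \<le> ?pack (fst \<omega>) is)
        \<longrightarrow> success n r \<epsilon> V (fst (fst (out \<omega>))) (fst (snd (out \<omega>))))"
    by (elim exE)
  note out = bspec[OF this]
  have exec: "execute n V (algorithm n r \<epsilon> t) = map_pmf out ?D"
    unfolding execute_algorithm map_pmf_def case_prod_unfold
    by (intro bind_pmf_cong refl) (use out in blast)
  show "real c1 \<le> 97 * (t * real r / \<epsilon>) \<and> real c2 \<le> 4 * (real n * ln (real n))"
    if "((Q, c1), (R, c2)) \<in> set_pmf (execute n V (algorithm n r \<epsilon> t))"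
  proof -
    from that obtain \<omega> where \<omega>: "\<omega> \<in> set_pmf ?D" "out \<omega> = ((Q, c1), (R, c2))" by (auto simp: exec)
    have "c1 \<le> ?N + ?J * (16 * r)" "c2 \<le> n + nat \<lceil>log 2 (real n)\<rceil> * n"
      using out[OF \<omega>(1)] \<omega>(2) by auto
    then have "real c1 \<le> real (?N + ?J * (16 * r))" "real c2 \<le> real (n + nat \<lceil>log 2 (real n)\<rceil> * n)"
      by (simp_all only: of_nat_le_iff)
    then show ?thesis
      using preassign_count_bound[OF r(1) t \<epsilon>] completion_count_bound[OF n] by linarith
  qed
  define B1 where "B1 = {(xs, iss :: nat list list). card (L \<inter> set xs) < 8 * r}"
  \<comment> \<open>All trials fail. The length condition makes the entries of \<open>chosen\<close>
    below \<open>8 * r\<close> meaningful; it holds automatically outside \<open>B1\<close>.\<close>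
  define B2 where "B2 = {(xs, iss). length (chosen n r \<epsilon> V xs) = 8 * r \<and> (\<forall>is\<in>set iss. is \<in> {is. ?pack xs is < r})}"
  have B1: "measure_pmf.prob ?D B1 \<le> 1 / (t\<^sup>2 * real r)"
  proof -
    have "measure_pmf.prob ?D B1 = measure_pmf.prob (map_pmf fst ?D) {xs. card (L \<inter> set xs) < 8 * r}"
      by (simp add: B1_def vimage_def case_prod_unfold)
    also have "\<dots> = measure_pmf.prob (replicate_pmf ?N (pmf_of_set {..<n})) {xs. card (L \<inter> set xs) < 8 * r}"
      by (simp add: draws_def map_fst_pair_pmf)
    \<comment> \<open>Here \<delta> is \<open>\<epsilon> / 2\<close>: \<open>L\<close> has at least
      \<open>\<epsilon> * n\<close> players, and \<open>8 * r\<close> is at most half of that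
      because \<open>127 * r \<le> \<epsilon> * n\<close>.\<close>
    also have "\<dots> \<le> 2 ^ (8 * r) * (1 - \<epsilon> / 2 / 2) ^ ?N"
      using v(1) r \<epsilon> n by (intro prob_few_distinct_hits) (auto simp: L_def)
    also have "\<dots> \<le> 1 / (t\<^sup>2 * real r)" by (rule sampling_bound[OF r(1) t \<epsilon>])
    finally show ?thesis .
  qed
  \<comment> \<open>For a fixed sample the subdivisions are fixed and the trials independent, so
    their failure probabilities multiply.\<close>
  have B2: "measure_pmf.prob ?D B2 \<le> 1 / (t\<^sup>2 * real r)"
    unfolding B2_def draws_def
  proof (rule prob_pair_pmf_le)
    fix xs assume "xs \<in> set_pmf (replicate_pmf ?N (pmf_of_set {..<n}))"
    then have xs: "set xs \<subseteq> {..<n}" by (auto simp: set_replicate_pmf supp_n)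
    let ?ps = "chosen n r \<epsilon> V xs"
    show "measure_pmf.prob (replicate_pmf ?J ?trial)
      {iss. length ?ps = 8 * r \<and> (\<forall>is\<in>set iss. is \<in> {is. ?pack xs is < r})} \<le> 1 / (t\<^sup>2 * real r)"
    proof (cases "length ?ps = 8 * r")
      case False
      then show ?thesis by simp
    next
      case True
      have "measure_pmf.prob ?trial {is. ?pack xs is < r} \<le> 1 / (4 * real r)"
      proof (rule prob_packing_number_less)
        fix p i j assume "p < 8 * r" "i \<le> j" "j \<le> 127 * r"
        moreover from this have "?ps ! p < n"
          using True chosen(2)[of n r \<epsilon> V xs] xs nth_mem[of p ?ps]
          by (metis lessThan_iff subsetD)
        moreover have "real j / real n \<le> 1"
        proof -
          have "real j \<le> 127 * real r" using \<open>j \<le> 127 * r\<close> by linarith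
          also have "\<dots> \<le> 1 * real n"
            using r(2) mult_right_mono[OF \<epsilon>(2), of "real n"] by linarith
          finally show ?thesis using n by simp
        qed
        ultimately show "mark n V (?ps ! p) (real i / real n) \<le> mark n V (?ps ! p) (real j / real n)"
          using V by (intro mark_mono) (auto simp: divide_right_mono)
      qed (use r in auto)
      then have "measure_pmf.prob ?trial {is. ?pack xs is < r} ^ ?J \<le> (1 / (4 * real r)) ^ ?J"
        by (intro power_mono) auto
      also have "\<dots> \<le> 1 / (t\<^sup>2 * real r)" using r t by (intro trials_bound) auto
      finally show ?thesis using True prob_all_replicate_pmf[of ?J ?trial "{is. ?pack xs is < r}"] by simp
    qed
  qed auto
  let ?S = "{((Q, c1 :: nat), (R, c2 :: nat)). success n r \<epsilon> V Q R}"
  have "1 - measure_pmf.prob ?D (B1 \<union> B2) = measure_pmf.prob ?D (- (B1 \<union> B2))"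
    by (subst measure_pmf.prob_compl[symmetric]) (auto simp: Compl_eq_Diff_UNIV)
  also have "\<dots> \<le> measure_pmf.prob ?D (out -` ?S)"
  proof (rule measure_pmf.finite_measure_mono_AE)
    show "AE \<omega> in ?D. \<omega> \<in> - (B1 \<union> B2) \<longrightarrow> \<omega> \<in> out -` ?S"
      unfolding AE_measure_pmf_iff
    proof (intro ballI impI)
      fix \<omega> assume \<omega>: "\<omega> \<in> set_pmf ?D" "\<omega> \<in> - (B1 \<union> B2)"
      have B: "8 * r \<le> card (L \<inter> set (fst \<omega>))" using \<omega>(2) by (simp add: B1_def case_prod_unfold)
      also have "\<dots> \<le> card (set (fst \<omega>))" by (intro card_mono) auto
      finally have "length (chosen n r \<epsilon> V (fst \<omega>)) = 8 * r" by (simp add: chosen(3))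
      then have "\<exists>is\<in>set (snd \<omega>). r \<le> ?pack (fst \<omega>) is"
        using \<omega>(2) by (auto simp: B2_def case_prod_unfold not_less)
      then have "success n r \<epsilon> V (fst (fst (out \<omega>))) (fst (snd (out \<omega>)))"
        using out[OF \<omega>(1)] B by blast
      then show "\<omega> \<in> out -` ?S" by (simp add: case_prod_unfold)
    qed
  qed simp
  also have "\<dots> = measure_pmf.prob (execute n V (algorithm n r \<epsilon> t)) ?S" by (simp add: exec)
  finally have "1 - measure_pmf.prob ?D (B1 \<union> B2) \<le> measure_pmf.prob (execute n V (algorithm n r \<epsilon> t)) ?S" .
  moreover have "measure_pmf.prob ?D (B1 \<union> B2) \<le> measure_pmf.prob ?D B1 + measure_pmf.prob ?D B2"
    by (rule measure_Un_le) auto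
  ultimately show "1 - 2 / (t\<^sup>2 * real r) \<le> measure_pmf.prob (execute n V (algorithm n r \<epsilon> t)) ?S"
    using B1 B2 by simp
qed

theorem theorem1:
  shows "\<exists>K1 K2 :: real. \<forall>(n::nat) (r::nat) (\<epsilon>::real) (t::real).
     0 < \<epsilon> \<and> \<epsilon> \<le> 1 \<and> 0 < r \<and> real r \<le> \<epsilon> * real n / 127 \<and> t > 3 / 2 \<longrightarrow>
     (\<exists>A :: two_part_algorithm. \<forall>V :: valuation. (\<forall>p<n. value_function (V p)) \<longrightarrow>
        (\<forall>Q c1 R c2. ((Q, c1), (R, c2)) \<in> set_pmf (execute n V A) \<longrightarrow>
           real c1 \<le> K1 * (t * real r / \<epsilon>) \<and>
           real c2 \<le> K2 * (real n * ln (real n))) \<and>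
        measure_pmf.prob (execute n V A) {((Q, c1), (R, c2)). success n r \<epsilon> V Q R}
          \<ge> 1 - 8 / ((2 * t - 3)\<^sup>2 * real r) - (1 / 64) powr (t / \<epsilon>))"
proof (rule exI[of _ 97], rule exI[of _ 4], intro allI impI, elim conjE)
  fix n r :: nat and \<epsilon> t :: real
  assume \<epsilon>: "0 < \<epsilon>" "\<epsilon> \<le> 1" and r: "0 < r" "real r \<le> \<epsilon> * real n / 127" and t: "3 / 2 < t"
  have r': "127 * real r \<le> \<epsilon> * real n" using r(2) by simp
  \<comment> \<open>As \<open>2 * t - 3\<close> lies between 0 and \<open>2 * t\<close>, the allowed
    failure term is at least the \<open>2 / (t^2 * r)\<close> obtained from the two bad events. The
    \<open>powr\<close> term only adds slack.\<close>
  have "(2 * t - 3)\<^sup>2 \<le> (2 * t)\<^sup>2" using t by (intro power_mono) auto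
  then have "(2 * t - 3)\<^sup>2 * real r \<le> 4 * (t\<^sup>2 * real r)"
    using mult_right_mono[of "(2 * t - 3)\<^sup>2" "(2 * t)\<^sup>2" "real r"] by (simp add: power_mult_distrib)
  then have "8 / (4 * (t\<^sup>2 * real r)) \<le> 8 / ((2 * t - 3)\<^sup>2 * real r)"
    using r t by (intro divide_left_mono) auto
  then have "2 / (t\<^sup>2 * real r) \<le> 8 / ((2 * t - 3)\<^sup>2 * real r)"
    using r t by (simp add: field_simps)
  then have bound: "1 - 8 / ((2 * t - 3)\<^sup>2 * real r) - (1 / 64) powr (t / \<epsilon>) \<le> 1 - 2 / (t\<^sup>2 * real r)"
    using powr_ge_zero[of "1 / 64" "t / \<epsilon>"] by linarith
  show "\<exists>A :: two_part_algorithm. \<forall>V :: valuation. (\<forall>p<n. value_function (V p)) \<longrightarrow>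
        (\<forall>Q c1 R c2. ((Q, c1), (R, c2)) \<in> set_pmf (execute n V A) \<longrightarrow>
           real c1 \<le> 97 * (t * real r / \<epsilon>) \<and>
           real c2 \<le> 4 * (real n * ln (real n))) \<and>
        measure_pmf.prob (execute n V A) {((Q, c1), (R, c2)). success n r \<epsilon> V Q R}
          \<ge> 1 - 8 / ((2 * t - 3)\<^sup>2 * real r) - (1 / 64) powr (t / \<epsilon>)"
    using algorithm_correct[OF _ \<epsilon> r(1) r' t] order_trans[OF bound]
    by (intro exI[of _ "algorithm n r \<epsilon> t"]) blast
qed

end
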